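(* There exist absolute constants $c,c'>0$ such that for all integers $k\ge2$ and $1\le\Delta\le ck$, $$n^*(k,\Delta)\ge c'\,\frac{k}{\log k}\log\frac k\Delta.$$ The same lower bound holds for the analogous sample complexity under sampling without replacement.
   Context: For an urn of $k$ colored balls let $C$ be its number of distinct colors. The sample complexity $n^*(k,\Delta)$ is the minimal integer $n$ such that there exists an integer-valued estimator $\hat C$ based on $n$ balls drawn independently and uniformly with replacement from the urn such that $\mathbb{P}[|\hat C-C|\ge\Delta]\le0.1$ for every urn containing $k$ balls. The without-replacement analog is defined identically except that the $n$ balls are drawn uniformly at random without replacement. Logarithms are natural. *)

theory Defs
  imports Complex_Main
begin

text \<open>An urn with k balls is modelled by a colouring u :: nat => nat; ball i (for i < k)
  has colour u i. Its number of distinct colours is card (u ` {..<k}).\<close>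

definition num_colors :: "nat \<Rightarrow> (nat \<Rightarrow> nat) \<Rightarrow> nat" where
  "num_colors k u = card (u ` {..<k})"

definition samples_wr :: "nat \<Rightarrow> nat \<Rightarrow> nat list set" where
  "samples_wr k n = {xs. length xs = n \<and> set xs \<subseteq> {..<k}}"

definition samples_wor :: "nat \<Rightarrow> nat \<Rightarrow> nat list set" where
  "samples_wor k n = {xs. length xs = n \<and> distinct xs \<and> set xs \<subseteq> {..<k}}"

definition fail_prob :: "nat list set \<Rightarrow> nat \<Rightarrow> (nat \<Rightarrow> nat) \<Rightarrow> (nat list \<Rightarrow> int) \<Rightarrow> real \<Rightarrow> real" where
  "fail_prob S k u est \<Delta> =
     real (card {xs \<in> S. \<bar>real_of_int (est (map u xs)) - real (num_colors k u)\<bar> \<ge> \<Delta>})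
     / real (card S)"

definition achievable :: "(nat \<Rightarrow> nat \<Rightarrow> nat list set) \<Rightarrow> nat \<Rightarrow> real \<Rightarrow> nat \<Rightarrow> bool" where
  "achievable samp k \<Delta> n \<longleftrightarrow>
     (\<exists>est :: nat list \<Rightarrow> int. \<forall>u :: nat \<Rightarrow> nat. fail_prob (samp k n) k u est \<Delta> \<le> 0.1)"

definition sample_complexity_wr :: "nat \<Rightarrow> real \<Rightarrow> nat" where
  "sample_complexity_wr k \<Delta> = (LEAST n. achievable samples_wr k \<Delta> n)"

definition sample_complexity_wor :: "nat \<Rightarrow> real \<Rightarrow> nat" where
  "sample_complexity_wor k \<Delta> = (LEAST n. achievable samples_wor k \<Delta> n)"

end

theory Submission
  imports Defs "HOL-Combinatorics.Permutations" "HOL-Computational_Algebra.Polynomial"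
begin

text \<open>
  Take a real polynomial \<open>f = (1 - X)\<^sup>L g\<close> with \<open>f(0) = 1\<close>, and let \<open>P\<close> and \<open>Q\<close> be the probability
  weights on the naturals with \<open>P - Q\<close> proportional to the coefficients of \<open>f\<close>. Fill \<open>k\<close> colour
  slots with independent numbers of balls, all drawn from \<open>P\<close> or all from \<open>Q\<close>, and give the
  balls left over one extra colour. As \<open>P(0) > Q(0)\<close>, the two random urns have numbers of colours
  that differ by \<open>k (P(0) - Q(0))\<close>, up to Chernoff fluctuations.

  A sample of \<open>n\<close> balls hardly distinguishes them. Exchanging \<open>P\<close> for \<open>Q\<close> in one slot changes the
  mean of a test by a combination of \<open>L\<close>-th finite differences, with the coefficients of \<open>g\<close>, of
  its mean as a function of the number of balls in that slot. In such a difference \<open>L\<close> balls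
  are recoloured independently, so a sample that misses one of them cancels; both sampling
  schemes contain \<open>L\<close> given balls with probability at most \<open>(n/k)\<^sup>L\<close>.

  It remains to find \<open>f\<close> with coefficients that are small even when the \<open>i\<close>-th one is weighted
  by \<open>1 + i\<close>, because the mean number of balls per slot must be below 1. The divided difference
  functional at the nodes \<open>0, 1, 4, \<dots>, m\<^sup>2\<close> and \<open>2, 3\<close> gives a polynomial of degree \<open>m\<^sup>2\<close> with
  bounded weighted norm and a zero of order at least \<open>m\<close> at 1, and its \<open>r\<close>-th power is used with
  \<open>r\<close> of order \<open>ln (k/\<Delta>)\<close> and \<open>m r\<close> of order \<open>ln k\<close>.
\<close>

section \<open>Exchangeable samples\<close>

text \<open>This symmetry under relabelling of the balls is all that the lower bound uses about a
  sampling scheme, so both schemes are treated at once. A set of lists stands for the uniform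
  distribution on it.\<close>

definition exchangeable :: "nat \<Rightarrow> nat \<Rightarrow> nat list set \<Rightarrow> bool" where
  "exchangeable k n S \<longleftrightarrow>
     finite S \<and> (\<forall>s\<in>S. length s = n \<and> set s \<subseteq> {..<k}) \<and>
     (\<forall>\<pi>. \<pi> permutes {..<k} \<longrightarrow> map \<pi> ` S = S)"

definition sample_mean :: "nat list set \<Rightarrow> (nat list \<Rightarrow> real) \<Rightarrow> nat list \<Rightarrow> real" where
  "sample_mean S \<phi> xs = (\<Sum>s\<in>S. \<phi> (map ((!) xs) s)) / real (card S)"

lemma inj_on_map_permutes:
  assumes "\<pi> permutes A"
  shows "inj_on (map \<pi>) S"
  using assms by (meson inj_on_subset list.inj_map permutes_inj subset_UNIV)

text \<open>One inclusion suffices, because an injective self-map of a finite set is onto.\<close>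

lemma exchangeableI:
  assumes "finite S" "\<And>s. s \<in> S \<Longrightarrow> length s = n \<and> set s \<subseteq> {..<k}"
    and inv: "\<And>\<pi> s. \<pi> permutes {..<k} \<Longrightarrow> s \<in> S \<Longrightarrow> map \<pi> s \<in> S"
  shows "exchangeable k n S"
  unfolding exchangeable_def
proof (intro conjI allI impI ballI)
  fix \<pi> :: "nat \<Rightarrow> nat" assume p: "\<pi> permutes {..<k}"
  show "map \<pi> ` S = S"
    by (rule endo_inj_surj[OF assms(1) _ inj_on_map_permutes[OF p]]) (use inv[OF p] in auto)
qed (use assms in auto)

lemma exchangeable_samples_wr: "exchangeable k n (samples_wr k n)"
proof (rule exchangeableI)
  show "finite (samples_wr k n)"
    unfolding samples_wr_def using finite_lists_length_eq[of "{..<k}" n]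
    by (simp add: conj_commute)
  fix \<pi> :: "nat \<Rightarrow> nat" and s assume "\<pi> permutes {..<k}" "s \<in> samples_wr k n"
  then show "map \<pi> s \<in> samples_wr k n"
    using permutes_in_image[of \<pi> "{..<k}"] by (auto simp: samples_wr_def)
qed (auto simp: samples_wr_def)

lemma exchangeable_samples_wor: "exchangeable k n (samples_wor k n)"
proof (rule exchangeableI)
  show "finite (samples_wor k n)"
    by (rule finite_subset[of _ "samples_wr k n"])
      (use exchangeable_samples_wr[of k n] in \<open>auto simp: samples_wr_def samples_wor_def exchangeable_def\<close>)
  fix \<pi> :: "nat \<Rightarrow> nat" and s assume p: "\<pi> permutes {..<k}" and "s \<in> samples_wor k n"
  then show "map \<pi> s \<in> samples_wor k n"
    using permutes_in_image[OF p] inj_on_subset[OF permutes_inj[OF p]]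
    by (auto simp: samples_wor_def distinct_map)
qed (auto simp: samples_wor_def)

text \<open>Lists with the same multiset differ by a permutation of positions, which only permutes
  the samples. Hence the balls of an urn may be listed in whatever order is convenient.\<close>

lemma sample_mean_mset_cong:
  assumes ex: "exchangeable k n S" and ms: "mset xs = mset ys" and len: "length xs = k"
  shows "sample_mean S \<phi> xs = sample_mean S \<phi> ys"
proof -
  obtain p where p: "p permutes {..<length ys}" "permute_list p ys = xs"
    using mset_eq_permutation[OF ms] .
  have ly: "length ys = k" using ms len by (metis size_mset)
  have inv: "map p ` S = S" using ex p ly by (simp add: exchangeable_def)
  have "map ((!) xs) s = map ((!) ys) (map p s)" if "s \<in> S" for s
  proof -
    have "set s \<subseteq> {..<k}" using that ex by (simp add: exchangeable_def)
    then show ?thesis using p ly by (auto simp: permute_list_nth subset_iff)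
  qed
  then have "(\<Sum>s\<in>S. \<phi> (map ((!) xs) s)) = (\<Sum>s\<in>S. \<phi> (map ((!) ys) (map p s)))"
    by (intro sum.cong refl arg_cong[of _ _ \<phi>])
  also have "\<dots> = (\<Sum>s\<in>map p ` S. \<phi> (map ((!) ys) s))"
    by (subst sum.reindex[OF inj_on_map_permutes[OF p(1)]]) simp
  finally show ?thesis by (simp add: sample_mean_def inv)
qed

text \<open>Induction on \<open>B\<close>, counting pairs of a sample containing \<open>B\<close>
  and a further ball in it. By symmetry all \<open>k - card B\<close> further balls occur equally
  often, while each sample has at most \<open>n - card B\<close> of them; the quotient of these two
  numbers is at most \<open>n / k\<close> since \<open>n \<le> k\<close>.\<close>

lemma card_samples_containing_le:
  assumes ex: "exchangeable k n S" and nk: "n \<le> k" and "finite B" "B \<subseteq> {..<k}"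
  shows "real (card {s \<in> S. B \<subseteq> set s}) \<le> (real n / real k) ^ card B * real (card S)"
  using assms(3,4)
proof (induction B rule: finite_induct)
  case empty
  then show ?case by simp
next
  case (insert b B)
  define c where "c X = card {s \<in> S. X \<subseteq> set s}" for X
  have finS: "finite S" using ex by (simp add: exchangeable_def)
  have Bk: "card B < k"
  proof -
    have "card (insert b B) \<le> card {..<k}" by (rule card_mono) (use insert.prems in auto)
    then show ?thesis using insert.hyps by simp
  qed
  have sym: "c (insert b' B) = c (insert b B)" if "b' \<in> {..<k} - B" for b'
  proof -
    let ?t = "transpose b b'"
    have t: "?t permutes {..<k}" using that insert.prems by (intro permutes_swap_id) auto
    have img: "?t ` insert b B = insert b' B"
    proof -
      have "?t ` B = B" using that insert.hyps by (auto simp: transpose_def)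
      then show ?thesis by simp
    qed
    have "map ?t ` {s \<in> S. insert b B \<subseteq> set s} = {s \<in> S. insert b' B \<subseteq> set s}"
    proof -
      have S: "map ?t ` S = S" using ex t by (simp add: exchangeable_def)
      have iff: "insert b B \<subseteq> set s \<longleftrightarrow> insert b' B \<subseteq> set (map ?t s)" for s
        unfolding img[symmetric] set_map
        by (rule inj_image_subset_iff[OF permutes_inj[OF t], symmetric])
      have "map ?t ` {s \<in> S. insert b B \<subseteq> set s}
          = {s \<in> map ?t ` S. insert b' B \<subseteq> set s}"
        using iff by blast
      then show ?thesis by (simp only: S)
    qed
    moreover have "card (map ?t ` {s \<in> S. insert b B \<subseteq> set s}) = c (insert b B)"
      unfolding c_def by (rule card_image) (rule inj_on_map_permutes[OF t])
    ultimately show ?thesis by (simp add: c_def)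
  qed
  have "(k - card B) * c (insert b B) = (\<Sum>b'\<in>{..<k} - B. c (insert b' B))"
  proof -
    have "(\<Sum>b'\<in>{..<k} - B. c (insert b' B)) = (\<Sum>b'\<in>{..<k} - B. c (insert b B))"
      by (intro sum.cong refl sym)
    then show ?thesis using insert.prems insert.hyps by (simp add: card_Diff_subset)
  qed
  also have "\<dots> = (\<Sum>b'\<in>{..<k} - B. \<Sum>s\<in>{s \<in> S. B \<subseteq> set s}. if b' \<in> set s then 1 else 0)"
    unfolding c_def using finS
    by (intro sum.cong refl) (simp add: sum.If_cases Int_def Collect_conj_eq[symmetric] conj_ac)
  also have "\<dots> = (\<Sum>s\<in>{s \<in> S. B \<subseteq> set s}. \<Sum>b'\<in>{..<k} - B. if b' \<in> set s then 1 else 0)"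
    by (rule sum.swap)
  also have "\<dots> \<le> (\<Sum>s\<in>{s \<in> S. B \<subseteq> set s}. n - card B)"
  proof (rule sum_mono)
    fix s assume s: "s \<in> {s \<in> S. B \<subseteq> set s}"
    have "(\<Sum>b'\<in>{..<k} - B. if b' \<in> set s then 1 else 0) = card (({..<k} - B) \<inter> set s)"
      by (simp add: sum.If_cases)
    also have "\<dots> \<le> card (set s - B)" by (intro card_mono) auto
    also have "\<dots> = card (set s) - card B" using s insert.hyps by (intro card_Diff_subset) auto
    also have "\<dots> \<le> n - card B"
      using s ex card_length[of s] by (auto simp: exchangeable_def intro: diff_le_mono)
    finally show "(\<Sum>b'\<in>{..<k} - B. if b' \<in> set s then 1 else 0) \<le> n - card B" .
  qed
  finally have main: "(k - card B) * c (insert b B) \<le> (n - card B) * c B"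
    by (simp add: c_def mult.commute)
  have kpos: "real (k - card B) > 0" using Bk by simp
  have "real (c (insert b B)) \<le> real n / real k * real (c B)"
  proof -
    have m: "real (k - card B) * c (insert b B) \<le> real (n - card B) * c B"
      using main by (metis of_nat_le_iff of_nat_mult)
    have "real (n - card B) * real k \<le> real n * real (k - card B)"
    \<comment> \<open>If \<open>card B\<close> exceeds \<open>n\<close>, the truncated difference on
      the left is 0.\<close>
    proof (cases "card B \<le> n")
      case True
      then have "real (n - card B) = real n - card B" "real (k - card B) = real k - card B"
        using nk by (auto simp: of_nat_diff)
      then show ?thesis using nk by (simp add: algebra_simps mult_right_mono)
    qed simp
    then have "real (n - card B) \<le> real n / real k * real (k - card B)"
      using Bk by (simp add: field_simps)
    then have "real (n - card B) * c B \<le> real n / real k * real (k - card B) * c B"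
      by (rule mult_right_mono) simp
    then have "real (k - card B) * c (insert b B) \<le> real (k - card B) * (real n / real k * c B)"
      using m by (simp add: mult_ac)
    then show ?thesis using kpos by (rule mult_left_le_imp_le)
  qed
  also have "\<dots> \<le> real n / real k * ((real n / real k) ^ card B * real (card S))"
    using insert by (intro mult_left_mono) (auto simp: c_def)
  finally show ?case using insert.hyps by (simp add: c_def)
qed

section \<open>Alternating sums over sets of recoloured balls\<close>

text \<open>The sets \<open>E\<close> and \<open>insert j E\<close> have opposite signs and cancel
  in pairs.\<close>

lemma alternating_sum_Pow_eq_0:
  fixes F :: "nat set \<Rightarrow> real"
  assumes fin: "finite A" and jA: "j \<in> A"
    and F: "\<And>E. E \<subseteq> A - {j} \<Longrightarrow> F (insert j E) = F E"
  shows "(\<Sum>E\<in>Pow A. (-1) ^ card E * F E) = 0"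
proof -
  have P: "Pow A = Pow (A - {j}) \<union> insert j ` Pow (A - {j})"
    using jA Pow_insert[of j "A - {j}"] by (simp add: insert_absorb)
  have inj: "inj_on (insert j) (Pow (A - {j}))"
    by (rule inj_onI) (auto simp: insert_eq_iff)
  have "(\<Sum>E\<in>insert j ` Pow (A - {j}). (-1) ^ card E * F E)
      = (\<Sum>E\<in>Pow (A - {j}). (-1) ^ card (insert j E) * F (insert j E))"
    by (subst sum.reindex[OF inj]) simp
  also have "\<dots> = (\<Sum>E\<in>Pow (A - {j}). - ((-1) ^ card E * F E))"
  proof (rule sum.cong[OF refl])
    fix E assume E: "E \<in> Pow (A - {j})"
    then have "finite E" "j \<notin> E" using fin by (auto intro: finite_subset)
    then show "(-1) ^ card (insert j E) * F (insert j E) = - ((-1) ^ card E * F E)"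
      using F E by simp
  qed
  finally show ?thesis
    unfolding P using fin by (subst sum.union_disjoint) (auto simp: sum_negf)
qed

text \<open>After interchanging the sums, a sample that misses some ball \<open>j < L\<close> does
  not see its colour and contributes 0. The remaining samples are at most a fraction
  \<open>(n / k)^L\<close> of all, and each contributes at most \<open>2^L\<close>.\<close>

lemma alternating_sample_mean_le:
  assumes ex: "exchangeable k n S" and nk: "n \<le> k" and len: "L + length ys = k"
    and phi: "\<And>l. \<bar>\<phi> l\<bar> \<le> 1"
  shows "\<bar>\<Sum>E\<in>Pow {..<L}. (-1) ^ card E *
      sample_mean S \<phi> (map (\<lambda>j. if j \<in> E then z else w) [0..<L] @ ys)\<bar> \<le> (2 * real n / real k) ^ L"
proof -
  define xs where "xs E = map (\<lambda>j. if j \<in> E then z else w) [0..<L] @ ys" for E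
  define G where "G s = (\<Sum>E\<in>Pow {..<L}. (-1) ^ card E * \<phi> (map ((!) (xs E)) s))" for s
  let ?B = "{s \<in> S. {..<L} \<subseteq> set s}"
  have finS: "finite S" using ex by (simp add: exchangeable_def)
  have G0: "G s = 0" if "s \<in> S - ?B" for s
  proof -
    have "\<not> {..<L} \<subseteq> set s" using that by simp
    then obtain j where j: "j < L" "j \<notin> set s" by blast
    show ?thesis unfolding G_def
    proof (rule alternating_sum_Pow_eq_0[of _ j])
      fix E
      show "\<phi> (map ((!) (xs (insert j E))) s) = \<phi> (map ((!) (xs E)) s)"
        using j by (intro arg_cong[of _ _ \<phi>] map_cong refl) (auto simp: xs_def nth_append)
    qed (use j in auto)
  qed
  have G1: "\<bar>G s\<bar> \<le> 2 ^ L" for s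
  proof -
    have "\<bar>G s\<bar> \<le> (\<Sum>E\<in>Pow {..<L}. \<bar>(-1) ^ card E * \<phi> (map ((!) (xs E)) s)\<bar>)"
      unfolding G_def by (rule sum_abs)
    also have "\<dots> \<le> (\<Sum>E\<in>Pow {..<L}. 1)"
      using phi by (intro sum_mono) (simp add: abs_mult power_abs)
    finally show ?thesis by (simp add: card_Pow)
  qed
  have "(\<Sum>E\<in>Pow {..<L}. (-1) ^ card E * sample_mean S \<phi> (xs E)) = (\<Sum>s\<in>S. G s) / card S"
    unfolding sample_mean_def G_def
    by (subst sum.swap) (simp add: sum_divide_distrib sum_distrib_left)
  also have "(\<Sum>s\<in>S. G s) = (\<Sum>s\<in>?B. G s)"
    by (rule sum.mono_neutral_right) (use finS G0 in auto)
  finally have eq: "(\<Sum>E\<in>Pow {..<L}. (-1) ^ card E * sample_mean S \<phi> (xs E)) = (\<Sum>s\<in>?B. G s) / card S" .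
  have "\<bar>\<Sum>s\<in>?B. G s\<bar> \<le> (\<Sum>s\<in>?B. 2 ^ L)"
    using G1 by (intro order_trans[OF sum_abs] sum_mono)
  also have "\<dots> = 2 ^ L * real (card ?B)" by simp
  also have "\<dots> \<le> 2 ^ L * ((real n / real k) ^ L * real (card S))"
    using card_samples_containing_le[OF ex nk, of "{..<L}"] len by (intro mult_left_mono) auto
  finally have "\<bar>\<Sum>s\<in>?B. G s\<bar> \<le> (2 * real n / real k) ^ L * real (card S)"
    by (simp add: power_mult_distrib power_divide)
  then have "\<bar>(\<Sum>s\<in>?B. G s) / card S\<bar> \<le> (2 * real n / real k) ^ L"
    \<comment> \<open>For empty \<open>S\<close> the division by 0 yields 0.\<close>
    by (cases "card S = 0") (auto simp: divide_simps)
  then show ?thesis using eq by (simp add: xs_def)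
qed

section \<open>Coefficient norms of polynomials\<close>

text \<open>A weighted l1 norm of the coefficients. It is used with the submultiplicative weights 1
  and \<open>1 + i\<close>; the second one controls the mean number of balls per slot.\<close>

definition pnorm :: "(nat \<Rightarrow> real) \<Rightarrow> real poly \<Rightarrow> real" where
  "pnorm a p = (\<Sum>i\<le>degree p. a i * \<bar>coeff p i\<bar>)"

lemma pnorm_eq_sum:
  assumes "finite S" "\<And>i. i \<notin> S \<Longrightarrow> coeff p i = 0"
  shows "pnorm a p = (\<Sum>i\<in>S. a i * \<bar>coeff p i\<bar>)"
proof -
  have "pnorm a p = (\<Sum>i\<in>S \<union> {..degree p}. a i * \<bar>coeff p i\<bar>)"
    unfolding pnorm_def using assms(1)
    by (intro sum.mono_neutral_left) (auto simp: coeff_eq_0)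
  also have "\<dots> = (\<Sum>i\<in>S. a i * \<bar>coeff p i\<bar>)"
    using assms by (intro sum.mono_neutral_right) auto
  finally show ?thesis .
qed

lemma pnorm_eq_sum_atMost: "degree p \<le> N \<Longrightarrow> pnorm a p = (\<Sum>i\<le>N. a i * \<bar>coeff p i\<bar>)"
  by (rule pnorm_eq_sum) (auto simp: coeff_eq_0)

lemma pnorm_nonneg: "(\<And>i. 0 \<le> a i) \<Longrightarrow> 0 \<le> pnorm a p"
  by (simp add: pnorm_def sum_nonneg)

lemma pnorm_monom: "pnorm a (monom c i) = a i * \<bar>c\<bar>"
  by (subst pnorm_eq_sum[of "{i}"]) auto

lemma pnorm_add_le:
  assumes "\<And>i. 0 \<le> a i"
  shows "pnorm a (p + q) \<le> pnorm a p + pnorm a q"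
proof -
  let ?N = "max (degree p) (degree q)"
  have "pnorm a (p + q) = (\<Sum>i\<le>?N. a i * \<bar>coeff p i + coeff q i\<bar>)"
    by (subst pnorm_eq_sum_atMost[of _ ?N]) (auto simp: degree_add_le_max)
  also have "\<dots> \<le> (\<Sum>i\<le>?N. a i * \<bar>coeff p i\<bar> + a i * \<bar>coeff q i\<bar>)"
    unfolding distrib_left[symmetric] using assms
    by (intro sum_mono mult_left_mono) auto
  also have "\<dots> = pnorm a p + pnorm a q"
    by (simp add: sum.distrib pnorm_eq_sum_atMost[of p ?N] pnorm_eq_sum_atMost[of q ?N])
  finally show ?thesis .
qed

lemma pnorm_sum_le:
  assumes "\<And>i. 0 \<le> a i" "finite A"
  shows "pnorm a (\<Sum>x\<in>A. f x) \<le> (\<Sum>x\<in>A. pnorm a (f x))"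
  using assms(2)
proof (induction A rule: finite_induct)
  case empty
  show ?case by (simp add: pnorm_def)
next
  case (insert x F)
  then show ?case using pnorm_add_le[of a "f x" "sum f F"] assms(1) by fastforce
qed

text \<open>Expanding both factors into monomials reduces this to the submultiplicativity of the
  weight.\<close>

lemma pnorm_mult_le:
  assumes "\<And>i. 0 \<le> a i" and sub: "\<And>i j. a (i + j) \<le> a i * a j"
  shows "pnorm a (p * q) \<le> pnorm a p * pnorm a q"
proof -
  have "p * q = (\<Sum>i\<le>degree p. \<Sum>j\<le>degree q. monom (coeff p i * coeff q j) (i + j))"
    unfolding mult_monom[symmetric] sum_product[symmetric] poly_as_sum_of_monoms ..
  then have "pnorm a (p * q)
      \<le> (\<Sum>i\<le>degree p. \<Sum>j\<le>degree q. pnorm a (monom (coeff p i * coeff q j) (i + j)))"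
    by (simp only:) (intro order_trans[OF pnorm_sum_le] sum_mono pnorm_sum_le assms(1) order_refl finite_atMost)
  also have "\<dots> \<le> (\<Sum>i\<le>degree p. \<Sum>j\<le>degree q. (a i * \<bar>coeff p i\<bar>) * (a j * \<bar>coeff q j\<bar>))"
  proof (intro sum_mono)
    fix i j
    have "a (i + j) * \<bar>coeff p i * coeff q j\<bar> \<le> a i * a j * \<bar>coeff p i * coeff q j\<bar>"
      by (intro mult_right_mono sub) simp
    then show "pnorm a (monom (coeff p i * coeff q j) (i + j))
        \<le> (a i * \<bar>coeff p i\<bar>) * (a j * \<bar>coeff q j\<bar>)"
      by (simp add: pnorm_monom abs_mult mult_ac)
  qed
  also have "\<dots> = pnorm a p * pnorm a q"
    by (simp add: pnorm_def sum_product)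
  finally show ?thesis .
qed

lemma pnorm_power_le:
  assumes "\<And>i. 0 \<le> a i" "\<And>i j. a (i + j) \<le> a i * a j" "a 0 = 1"
  shows "pnorm a (p ^ r) \<le> pnorm a p ^ r"
proof (induction r)
  case 0
  show ?case using pnorm_monom[of a 1 0] assms(3) by (simp add: monom_0 one_pCons)
next
  case (Suc r)
  have "pnorm a (p ^ Suc r) \<le> pnorm a p * pnorm a (p ^ r)"
    using pnorm_mult_le[OF assms(1,2)] by simp
  also have "\<dots> \<le> pnorm a p * pnorm a p ^ r"
    by (intro mult_left_mono Suc pnorm_nonneg assms)
  finally show ?case by simp
qed

text \<open>Dividing by \<open>1 - X\<close> replaces the coefficients by their partial sums. Doing
  this \<open>m\<close> times sums the bounds by Pascal's rule.\<close>

lemma coeff_quotient_le: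
  assumes "f = [:1, -1:] ^ m * g"
  shows "\<bar>coeff g i\<bar> \<le> pnorm (\<lambda>_. 1) f * real ((i + m) choose m)"
  using assms
proof (induction m arbitrary: g i)
  case 0
  have "\<bar>coeff f i\<bar> \<le> pnorm (\<lambda>_. 1) f"
  proof (cases "i \<le> degree f")
    case True
    then show ?thesis unfolding pnorm_def
      using member_le_sum[of i "{..degree f}" "\<lambda>i. \<bar>coeff f i\<bar>"] by simp
  qed (simp add: coeff_eq_0 pnorm_nonneg)
  then show ?case using 0 by simp
next
  case (Suc m)
  let ?h = "[:1, -1:] * g"
  have h: "\<bar>coeff ?h i\<bar> \<le> pnorm (\<lambda>_. 1) f * real ((i + m) choose m)" for i
    by (rule Suc.IH) (use Suc.prems in \<open>simp only: power_Suc2 mult.assoc\<close>)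
  show ?case
  proof (induction i)
    case 0
    show ?case using h[of 0] by simp
  next
    case (Suc i)
    have "coeff g (Suc i) = coeff ?h (Suc i) + coeff g i" by simp
    then have "\<bar>coeff g (Suc i)\<bar> \<le> \<bar>coeff ?h (Suc i)\<bar> + \<bar>coeff g i\<bar>" by linarith
    also have "\<dots> \<le> pnorm (\<lambda>_. 1) f * real ((Suc i + m) choose m)
        + pnorm (\<lambda>_. 1) f * real ((i + Suc m) choose Suc m)"
      using h[of "Suc i"] Suc.IH by simp
    also have "\<dots> = pnorm (\<lambda>_. 1) f * real ((Suc i + Suc m) choose Suc m)"
      by (simp add: algebra_simps)
    finally show ?case .
  qed
qed

section \<open>Divided differences and zeros at 1\<close>

text \<open>The image of \<open>x \<mapsto> X\<^sup>x\<close> under the divided difference functional at the nodes \<open>S\<close>.\<close>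

definition dd_poly :: "nat set \<Rightarrow> real poly" where
  "dd_poly S = (\<Sum>x\<in>S. monom (1 / (\<Prod>y\<in>S - {x}. real x - real y)) x)"

lemma coeff_dd_poly:
  "finite S \<Longrightarrow> coeff (dd_poly S) i = (if i \<in> S then 1 / (\<Prod>y\<in>S - {i}. real i - real y) else 0)"
  by (simp add: dd_poly_def coeff_sum sum.delta' if_distrib cong: if_cong)

text \<open>The Euler operator multiplies coefficient \<open>i\<close> by \<open>i\<close>, so
  subtracting \<open>s\<close> times the polynomial produces the factor \<open>i - s\<close>, which
  cancels the factor of node \<open>s\<close> in the denominator.\<close>

lemma dd_poly_remove:
  assumes "finite S" "s \<in> S"
  shows "[:0, 1:] * pderiv (dd_poly S) - smult (real s) (dd_poly S) = dd_poly (S - {s})"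
proof (rule poly_eqI)
  fix i
  have "coeff ([:0, 1:] * pderiv (dd_poly S)) i = real i * coeff (dd_poly S) i"
    by (cases i) (simp_all add: coeff_pderiv)
  then have "coeff ([:0, 1:] * pderiv (dd_poly S) - smult (real s) (dd_poly S)) i
      = (real i - real s) * coeff (dd_poly S) i"
    by (simp add: algebra_simps)
  also have "\<dots> = coeff (dd_poly (S - {s})) i"
  proof (cases "i \<in> S - {s}")
    case True
    have "(\<Prod>y\<in>S - {i}. real i - real y) = (real i - real s) * (\<Prod>y\<in>S - {i} - {s}. real i - real y)"
      using True assms by (intro prod.remove) auto
    moreover have "S - {i} - {s} = S - {s} - {i}" by auto
    ultimately show ?thesis using True assms by (simp add: coeff_dd_poly)
  qed (use assms in \<open>auto simp: coeff_dd_poly\<close>)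
  finally show "coeff ([:0, 1:] * pderiv (dd_poly S) - smult (real s) (dd_poly S)) i
      = coeff (dd_poly (S - {s})) i" .
qed

text \<open>Write a nonzero \<open>p\<close> as \<open>(x - 1)^(j + 1) q\<close> with
  \<open>q(1)\<close> nonzero. The operator turns it into \<open>(x - 1)^j R\<close> with
  \<open>R(1) = (j + 1) q(1)\<close>, again nonzero, so it lowers the order of the zero at 1 by
  exactly one.\<close>

lemma power_dvd_if_dvd_Euler_operator:
  fixes p :: "real poly"
  assumes p1: "poly p 1 = 0"
    and dv: "[:-1, 1:] ^ c dvd [:0, 1:] * pderiv p - smult s p"
  shows "[:-1, 1:] ^ Suc c dvd p"
proof (cases "p = 0")
  case False
  \<comment> \<open>Here \<open>X\<close> is the linear factor \<open>x - 1\<close> and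
    \<open>Y\<close> is the indeterminate.\<close>
  define X :: "real poly" where "X = [:-1, 1:]"
  define Y :: "real poly" where "Y = [:0, 1:]"
  have XY: "poly X 1 = 0" "poly Y 1 = 1" "X \<noteq> 0" "pderiv X = 1"
    by (simp_all add: X_def Y_def pderiv_pCons)
  obtain q where q: "p = X ^ order 1 p * q" "\<not> X dvd q"
    using order_decomp[OF False, of 1] by (auto simp: X_def)
  obtain j where j: "order 1 p = Suc j"
    using p1 False by (metis order_root not0_implies_Suc)
  have p: "p = X ^ Suc j * q" using q j by simp
  define R where "R = smult (real (Suc j)) (Y * q) + X * (Y * pderiv q - smult s q)"
  have "pderiv p = X ^ Suc j * pderiv q + smult (real (Suc j)) (X ^ j) * q"
    unfolding p by (simp only: pderiv_mult pderiv_power_Suc XY mult_1_right mult.commute)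
  then have "Y * pderiv p - smult s p
      = Y * (X ^ Suc j * pderiv q + smult (real (Suc j)) (X ^ j) * q) - smult s (X ^ Suc j * q)"
    using p by simp
  also have "\<dots> = X ^ j * R"
    unfolding R_def power_Suc
    by (simp only: algebra_simps mult_smult_left mult_smult_right smult_diff_right)
  finally have eq: "Y * pderiv p - smult s p = X ^ j * R" .
  have "\<not> j < c"
  proof
    assume "j < c"
    then have "X ^ Suc j dvd X ^ j * R"
      using dv eq unfolding X_def Y_def by (metis dvd_trans le_imp_power_dvd Suc_leI)
    then have "X dvd R" using XY(3) by (simp add: power_Suc2)
    then have "poly R 1 = 0" using XY(1) by (auto elim!: dvdE)
    then have "poly q 1 = 0" using XY by (simp add: R_def)
    then show False using q(2) by (simp add: poly_eq_0_iff_dvd X_def)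
  qed
  then have "X ^ Suc c dvd X ^ Suc j" by (intro le_imp_power_dvd) auto
  then show ?thesis using p unfolding X_def by (metis dvd_mult2)
qed simp

text \<open>Dropping node \<open>s\<close> and dropping node \<open>t\<close> give polynomials that
  differ by \<open>t - s\<close> times \<open>dd_poly S\<close>. They agree at 1, both being 1 for
  single nodes and 0 otherwise, so \<open>dd_poly S\<close> vanishes at 1, and the Euler operator
  then raises the order by one. The second conjunct serves the single nodes.\<close>

lemma dd_poly_vanishing:
  "card S = Suc c \<Longrightarrow> [:-1, 1:] ^ c dvd dd_poly S \<and> (c = 0 \<longrightarrow> poly (dd_poly S) 1 = 1)"
proof (induction c arbitrary: S)
  case 0
  then obtain x where "S = {x}" by (auto simp: card_Suc_eq)
  then show ?case by (simp add: dd_poly_def poly_monom)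
next
  case (Suc c)
  then have fin: "finite S" by (metis card.infinite nat.distinct(1))
  obtain s where s: "s \<in> S" using Suc.prems by fastforce
  have "card (S - {s}) = Suc c" using Suc.prems s fin by simp
  then obtain t where t: "t \<in> S" "t \<noteq> s"
    by (metis DiffD1 DiffD2 card.empty equals0I insertI1 nat.distinct(1))
  have cs: "card (S - {s}) = Suc c" "card (S - {t}) = Suc c" using Suc.prems s t fin by simp_all
  have "poly (dd_poly (S - {s})) 1 = poly (dd_poly (S - {t})) 1"
  proof (cases c)
    case (Suc c')
    then have "[:-1, 1:] dvd dd_poly (S - {s})" "[:-1, 1:] dvd dd_poly (S - {t})"
      using Suc.IH[OF cs(1)] Suc.IH[OF cs(2)] by (meson dvd_power dvd_trans zero_less_Suc)+
    then show ?thesis by (simp add: poly_eq_0_iff_dvd[symmetric])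
  qed (use Suc.IH[OF cs(1)] Suc.IH[OF cs(2)] in simp)
  moreover have "dd_poly (S - {s}) - dd_poly (S - {t}) = smult (real t - real s) (dd_poly S)"
    using dd_poly_remove[OF fin s] dd_poly_remove[OF fin t(1)] by (simp add: algebra_simps smult_diff_left)
  ultimately have "(real t - real s) * poly (dd_poly S) 1 = 0"
    by (metis diff_self poly_diff poly_smult)
  then have "poly (dd_poly S) 1 = 0" using t by simp
  then have "[:-1, 1:] ^ Suc c dvd dd_poly S"
    using Suc.IH[OF cs(1)] dd_poly_remove[OF fin s]
    by (intro power_dvd_if_dvd_Euler_operator[of _ _ "real s"]) auto
  then show ?case by simp
qed

section \<open>A polynomial with a high-order zero and small coefficients\<close>

text \<open>The factors \<open>j - i\<close> and \<open>j + i\<close> of the denominators telescope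
  into factorials separately.\<close>

lemma prod_square_ratio_below:
  assumes "t < j"
  shows "(\<Prod>i=1..t. (real i)\<^sup>2 / ((real j)\<^sup>2 - (real i)\<^sup>2))
       = (fact t)\<^sup>2 * fact (j - t - 1) * fact j / (fact (j - 1) * fact (j + t))"
  using assms
proof (induction t)
  case 0
  then show ?case by simp
next
  case (Suc t)
  obtain d where d: "j = Suc (Suc t) + d" using Suc.prems less_iff_Suc_add by auto
  have e1: "fact (j - t - 1) = (real j - real (Suc t)) * (fact (j - Suc t - 1) :: real)"
    using d by simp
  have e2: "fact (j + Suc t) = (real j + real (Suc t)) * (fact (j + t) :: real)"
    by simp
  have e3: "(real j)\<^sup>2 - (real (Suc t))\<^sup>2 = (real j - real (Suc t)) * (real j + real (Suc t))"
    by (simp add: power2_eq_square algebra_simps)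
  have e4: "(fact (Suc t))\<^sup>2 = (real (Suc t))\<^sup>2 * (fact t)\<^sup>2"
    by (simp add: power_mult_distrib)
  have nz: "real j - real (Suc t) \<noteq> 0" "real j + real (Suc t) \<noteq> 0" using d by auto
  have "(\<Prod>i=1..Suc t. (real i)\<^sup>2 / ((real j)\<^sup>2 - (real i)\<^sup>2))
      = (real (Suc t))\<^sup>2 / ((real j)\<^sup>2 - (real (Suc t))\<^sup>2) *
        ((fact t)\<^sup>2 * fact (j - t - 1) * fact j / (fact (j - 1) * fact (j + t)))"
    using Suc by (simp add: prod.nat_ivl_Suc' mult_ac)
  then show ?case
    unfolding e1 e2 e3 e4 using nz by (simp add: divide_simps mult_ac)
qed

text \<open>Induction on \<open>m\<close> upwards from \<open>j\<close>, so that the base case only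
  has factors with \<open>i < j\<close> and each later factor has \<open>i > j\<close>.\<close>

lemma prod_square_ratio:
  assumes "1 \<le> j" "j \<le> m"
  shows "(\<Prod>i\<in>{1..m} - {j}. (real i)\<^sup>2 / \<bar>(real j)\<^sup>2 - (real i)\<^sup>2\<bar>)
       = 2 * (fact m)\<^sup>2 / (fact (m - j) * fact (m + j))"
  using assms(2)
proof (induction m rule: dec_induct)
  case base
  have S: "{1..j} - {j} = {1..j - 1}" using assms by auto
  have "(\<Prod>i\<in>{1..j} - {j}. (real i)\<^sup>2 / \<bar>(real j)\<^sup>2 - (real i)\<^sup>2\<bar>)
      = (\<Prod>i=1..j - 1. (real i)\<^sup>2 / ((real j)\<^sup>2 - (real i)\<^sup>2))"
    unfolding S using assms by (intro prod.cong refl) (auto simp: abs_of_nonneg power_mono)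
  also have "\<dots> = (fact (j - 1))\<^sup>2 * fact j / (fact (j - 1) * fact (j + (j - 1)))"
    using assms by (subst prod_square_ratio_below) auto
  also have "\<dots> = 2 * (fact j)\<^sup>2 / fact (j + j)"
  proof -
    obtain i where i: "j = Suc i" using assms by (cases j) auto
    have "(fact (j + j) :: real) = 2 * real j * fact (j + (j - 1))" unfolding i by simp
    moreover have "(fact j :: real) = real j * fact (j - 1)" unfolding i by simp
    ultimately show ?thesis using i by (simp add: divide_simps power2_eq_square)
  qed
  finally show ?case by simp
next
  case (step m)
  have S: "{1..Suc m} - {j} = insert (Suc m) ({1..m} - {j})" using step by auto
  have e1: "fact (Suc m - j) = (real (Suc m) - real j) * (fact (m - j) :: real)"
    using step by (simp add: Suc_diff_le of_nat_diff)
  have e2: "fact (Suc m + j) = (real (Suc m) + real j) * (fact (m + j) :: real)"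
    by simp
  have e3: "\<bar>(real j)\<^sup>2 - (real (Suc m))\<^sup>2\<bar> = (real (Suc m) - real j) * (real (Suc m) + real j)"
  proof -
    have "(real j)\<^sup>2 \<le> (real (Suc m))\<^sup>2" using step by (intro power_mono) auto
    then show ?thesis by (simp add: power2_eq_square algebra_simps)
  qed
  have nz: "real (Suc m) - real j \<noteq> 0" "real (Suc m) + real j \<noteq> 0" using step by auto
  have e4: "(fact (Suc m))\<^sup>2 = (real (Suc m))\<^sup>2 * (fact m)\<^sup>2"
    by (simp add: power_mult_distrib)
  have "(\<Prod>i\<in>{1..Suc m} - {j}. (real i)\<^sup>2 / \<bar>(real j)\<^sup>2 - (real i)\<^sup>2\<bar>)
     = (real (Suc m))\<^sup>2 / \<bar>(real j)\<^sup>2 - (real (Suc m))\<^sup>2\<bar> *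
       (2 * (fact m)\<^sup>2 / (fact (m - j) * fact (m + j)))"
    unfolding S using step.IH by (subst prod.insert) auto
  then show ?case unfolding e1 e2 e3 e4 using nz by (simp add: divide_simps mult_ac)
qed

text \<open>The central binomial coefficient is the largest, hence \<open>(m!)^2\<close> is at most
  \<open>(m - j)! (m + j)!\<close>.\<close>

lemma prod_square_ratio_le:
  assumes "1 \<le> j" "j \<le> m"
  shows "(\<Prod>i\<in>{1..m} - {j}. (real i)\<^sup>2 / \<bar>(real j)\<^sup>2 - (real i)\<^sup>2\<bar>) \<le> 2"
proof -
  have "real ((2 * m) choose (m + j)) \<le> real ((2 * m) choose m)"
    by (simp only: of_nat_le_iff binomial_maximum')
  then have "fact (2 * m) / (fact (m + j) * fact (m - j)) \<le> (fact (2 * m) / (fact m * fact m) :: real)"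
    using assms by (simp add: binomial_fact mult_2)
  then have "(fact m * fact m :: real) \<le> fact (m + j) * fact (m - j)"
    by (simp add: divide_simps)
  then show ?thesis
    unfolding prod_square_ratio[OF assms] by (simp add: divide_simps power2_eq_square mult.commute)
qed

text \<open>The product telescopes by \<open>i^2 - 4 = (i - 2) (i + 2)\<close>, with limit
  6.\<close>

lemma prod_shifted_square_ratio:
  assumes "2 \<le> m"
  shows "(\<Prod>i=3..m. (real i)\<^sup>2 / ((real i)\<^sup>2 - 4)) = 6 * real m * (real m - 1) / ((real m + 1) * (real m + 2))"
  using assms
proof (induction m rule: dec_induct)
  case base
  then show ?case by simp
next
  case (step m)
  have e: "(real (Suc m))\<^sup>2 - 4 = (real m - 1) * (real m + 3)"
    by (simp add: power2_eq_square algebra_simps)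
  have nz: "real m - 1 \<noteq> 0" using step by simp
  have "(\<Prod>i=3..Suc m. (real i)\<^sup>2 / ((real i)\<^sup>2 - 4))
      = (real (Suc m))\<^sup>2 / ((real m - 1) * (real m + 3)) *
        (6 * real m * (real m - 1) / ((real m + 1) * (real m + 2)))"
    unfolding e[symmetric] step.IH[symmetric] using step.hyps by (subst prod.nat_ivl_Suc') auto
  also have "\<dots> = 6 * real (Suc m) * (real (Suc m) - 1) / ((real (Suc m) + 1) * (real (Suc m) + 2))"
    using nz by (simp add: divide_simps power2_eq_square) (simp add: algebra_simps)
  finally show ?case .
qed

text \<open>The factors for \<open>i = 1, 2\<close> are computed exactly, and in the others
  \<open>a\<close> may be replaced by 4. The values needed are the extra nodes \<open>a = 2\<close>
  and \<open>a = 3\<close>, where the bound is 12.\<close>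

lemma prod_shifted_square_ratio_le:
  fixes a :: real
  assumes m: "2 \<le> m" and a: "1 < a" "a < 4"
  shows "(\<Prod>i=1..m. (real i)\<^sup>2 / \<bar>a - (real i)\<^sup>2\<bar>) \<le> 24 / ((a - 1) * (4 - a))"
proof -
  have "{1..m} = {1,2} \<union> {3..m}" using m by auto
  then have "(\<Prod>i=1..m. (real i)\<^sup>2 / \<bar>a - (real i)\<^sup>2\<bar>)
     = (\<Prod>i\<in>{1,2}. (real i)\<^sup>2 / \<bar>a - (real i)\<^sup>2\<bar>) * (\<Prod>i=3..m. (real i)\<^sup>2 / \<bar>a - (real i)\<^sup>2\<bar>)"
    by (simp only:) (intro prod.union_disjoint, auto)
  also have "(\<Prod>i\<in>{1::nat,2}. (real i)\<^sup>2 / \<bar>a - (real i)\<^sup>2\<bar>) = 4 / ((a - 1) * (4 - a))"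
    using a by simp
  also have "(\<Prod>i=3..m. (real i)\<^sup>2 / \<bar>a - (real i)\<^sup>2\<bar>) \<le> (\<Prod>i=3..m. (real i)\<^sup>2 / ((real i)\<^sup>2 - 4))"
  proof (intro prod_mono conjI divide_left_mono)
    fix i assume "i \<in> {3..m}"
    then have "(real i)\<^sup>2 \<ge> 3\<^sup>2" by (intro power_mono) auto
    then have i: "(real i)\<^sup>2 \<ge> 9" by simp
    then show "(real i)\<^sup>2 - 4 \<le> \<bar>a - (real i)\<^sup>2\<bar>" "0 < \<bar>a - (real i)\<^sup>2\<bar> * ((real i)\<^sup>2 - 4)"
      using a by auto
  qed auto
  also have "\<dots> \<le> 6"
    unfolding prod_shifted_square_ratio[OF m] using m by (simp add: divide_simps) (simp add: algebra_simps)
  finally show ?thesis using a by (simp add: divide_simps)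
qed

lemma sum_inverse_quartic_le:
  "(\<Sum>j=1..m. (1 + (real j)\<^sup>2) * (12 / (\<bar>(real j)\<^sup>2 - 2\<bar> * \<bar>(real j)\<^sup>2 - 3\<bar>))) \<le> 60"
proof -
  define t where "t j = (1 + (real j)\<^sup>2) * (12 / (\<bar>(real j)\<^sup>2 - 2\<bar> * \<bar>(real j)\<^sup>2 - 3\<bar>))" for j
  have tail: "t j \<le> 36 * (1 / (real j - 1) - 1 / real j)" if "3 \<le> j" for j
  proof -
    have j: "3 \<le> real j" using that by simp
    have j2: "9 \<le> (real j)\<^sup>2" using power_mono[OF j, of 2] by simp
    define y where "y = (real j)\<^sup>2"
    have y: "9 \<le> y" using j2 by (simp add: y_def)
    have "(1 + y) * y \<le> 3 * ((y - 2) * (y - 3))"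
    proof -
      have "0 \<le> (y - 8) * (2 * y) + 18" using y by simp
      then show ?thesis by (simp add: algebra_simps)
    qed
    then have "(1 + y) / ((y - 2) * (y - 3)) \<le> 3 / y"
      using y by (simp add: divide_simps mult_ac)
    then have "t j \<le> 36 / y"
      using y mult_left_mono[of "(1 + y) / ((y - 2) * (y - 3))" "3 / y" 12]
      unfolding t_def y_def[symmetric] by (simp add: abs_of_nonneg algebra_simps)
    also have "\<dots> \<le> 36 / (real j * (real j - 1))"
      using j unfolding y_def power2_eq_square by (intro divide_left_mono) auto
    also have "\<dots> = 36 * (1 / (real j - 1) - 1 / real j)"
      using j by (simp add: field_simps)
    finally show ?thesis .
  qed
  \<comment> \<open>The first two terms are 12 and 30, with sum 42 = 60 - 36/2; from the third term
    on the tail bound telescopes.\<close>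
  have "(\<Sum>j=1..m. t j) \<le> 60 - (if m < 2 then 18 else 36 / real m)"
  proof (induction m)
    case (Suc m)
    consider "m = 0" | "m = 1" | "2 \<le> m" by linarith
    then show ?case
    proof cases
      case 3
      then show ?thesis using Suc tail[of "Suc m"] by (simp add: right_diff_distrib)
    qed (simp_all add: t_def numeral_eq_Suc)
  qed simp
  moreover have "0 \<le> (if m < 2 then 18 else 36 / real m)" by simp
  ultimately show ?thesis unfolding t_def by linarith
qed

text \<open>The squares are spaced like Chebyshev nodes; the nodes 2 and 3 make the coefficient of
  \<open>X\<close> to the power \<open>j\<^sup>2\<close> decay like the inverse fourth power of \<open>j\<close>, so that the weighted norm of
  \<open>base_poly m\<close> is bounded independently of \<open>m\<close>.\<close>

definition nodes :: "nat \<Rightarrow> nat set" where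
  "nodes m = {0, 2, 3} \<union> power2 ` {1..m}"

text \<open>The scalar is the denominator of the coefficient at node 0, which normalises the
  constant coefficient to 1.\<close>

definition base_poly :: "nat \<Rightarrow> real poly" where
  "base_poly m = smult (\<Prod>y\<in>nodes m - {0}. - real y) (dd_poly (nodes m))"

lemma finite_nodes [simp]: "finite (nodes m)"
  by (simp add: nodes_def)

lemma square_not_2_3 [simp]: "(j::nat)\<^sup>2 \<noteq> 2" "(j::nat)\<^sup>2 \<noteq> 3" "2 \<noteq> (j::nat)\<^sup>2" "3 \<noteq> (j::nat)\<^sup>2"
proof -
  have "j\<^sup>2 \<le> 1" if "j \<le> 1" using power_mono[OF that, of 2] by simp
  moreover have "4 \<le> j\<^sup>2" if "2 \<le> j" using power_mono[OF that, of 2] by simp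
  moreover have "j \<le> 1 \<or> 2 \<le> j" by linarith
  ultimately show "j\<^sup>2 \<noteq> 2" "j\<^sup>2 \<noteq> 3" "2 \<noteq> j\<^sup>2" "3 \<noteq> j\<^sup>2" by auto
qed

lemma inj_power2_nat: "inj_on (power2 :: nat \<Rightarrow> nat) A"
  by (auto simp: inj_on_def)

lemma card_nodes: "card (nodes m) = m + 3"
proof -
  have "card (nodes m) = card {0, 2, 3 :: nat} + card (power2 ` {1..m} :: nat set)"
    unfolding nodes_def by (intro card_Un_disjoint) auto
  then show ?thesis by (simp add: card_image inj_power2_nat)
qed

lemma coeff_base_poly_0: "coeff (base_poly m) 0 = 1"
  by (auto simp: base_poly_def coeff_dd_poly nodes_def)

lemma coeff_base_poly_outside: "x \<notin> nodes m \<Longrightarrow> coeff (base_poly m) x = 0"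
  by (simp add: base_poly_def coeff_dd_poly)

text \<open>The factor of node 0 in the denominator equals the factor \<open>y = x\<close> of the
  normalising scalar, and the two cancel.\<close>

lemma coeff_base_poly:
  assumes "x \<in> nodes m - {0}"
  shows "\<bar>coeff (base_poly m) x\<bar> = (\<Prod>y\<in>nodes m - {0} - {x}. real y / \<bar>real x - real y\<bar>)"
proof -
  have "(\<Prod>y\<in>nodes m - {0}. \<bar>- real y\<bar>) = \<bar>- real x\<bar> * (\<Prod>y\<in>nodes m - {0} - {x}. \<bar>- real y\<bar>)"
    using assms by (intro prod.remove) auto
  moreover have "(\<Prod>y\<in>nodes m - {x}. \<bar>real x - real y\<bar>)
      = \<bar>real x - real 0\<bar> * (\<Prod>y\<in>nodes m - {x} - {0}. \<bar>real x - real y\<bar>)"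
    using assms by (intro prod.remove) (auto simp: nodes_def)
  moreover have "nodes m - {x} - {0} = nodes m - {0} - {x}" by auto
  ultimately show ?thesis
    using assms by (simp add: base_poly_def coeff_dd_poly abs_mult abs_prod prod_dividef)
qed

text \<open>The nodes 2 and 3 contribute the numerator 6 and the denominator; the other squares
  contribute at most 2.\<close>

lemma coeff_base_poly_square:
  assumes "j \<in> {1..m}"
  shows "\<bar>coeff (base_poly m) (j\<^sup>2)\<bar> \<le> 12 / (\<bar>(real j)\<^sup>2 - 2\<bar> * \<bar>(real j)\<^sup>2 - 3\<bar>)"
proof -
  have j: "j\<^sup>2 \<in> nodes m - {0}" using assms by (auto simp: nodes_def)
  have "power2 ` {1..m} - {j\<^sup>2} = power2 ` ({1..m} - {j})"
    by (subst inj_on_image_set_diff[OF inj_power2_nat[of UNIV]]) auto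
  then have N: "nodes m - {0} - {j\<^sup>2} = {2, 3} \<union> power2 ` ({1..m} - {j})"
    unfolding nodes_def by auto
  have "\<bar>coeff (base_poly m) (j\<^sup>2)\<bar>
      = (\<Prod>y\<in>{2, 3}. real y / \<bar>real (j\<^sup>2) - real y\<bar>) *
        (\<Prod>y\<in>power2 ` ({1..m} - {j}). real y / \<bar>real (j\<^sup>2) - real y\<bar>)"
    unfolding coeff_base_poly[OF j] N 
    by (intro prod.union_disjoint) auto
  also have "(\<Prod>y\<in>power2 ` ({1..m} - {j}). real y / \<bar>real (j\<^sup>2) - real y\<bar>)
      = (\<Prod>i\<in>{1..m} - {j}. (real i)\<^sup>2 / \<bar>(real j)\<^sup>2 - (real i)\<^sup>2\<bar>)"
    by (subst prod.reindex[OF inj_power2_nat]) simp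
  also have "(\<Prod>y\<in>{2, 3}. real y / \<bar>real (j\<^sup>2) - real y\<bar>) * \<dots>
      \<le> (\<Prod>y\<in>{2, 3}. real y / \<bar>real (j\<^sup>2) - real y\<bar>) * 2"
    using assms by (intro mult_left_mono prod_square_ratio_le) auto
  finally show ?thesis by simp
qed

lemma coeff_base_poly_2_3:
  assumes m: "2 \<le> m"
  shows "\<bar>coeff (base_poly m) 2\<bar> \<le> 36" "\<bar>coeff (base_poly m) 3\<bar> \<le> 24"
proof -
  have N: "nodes m - {0} - {2} = insert 3 (power2 ` {1..m})" "nodes m - {0} - {3} = insert 2 (power2 ` {1..m})"
    unfolding nodes_def by auto
  have ni: "3 \<notin> (power2 ` {1..m} :: nat set)" "2 \<notin> (power2 ` {1..m} :: nat set)"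
    by auto
  have re: "(\<Prod>y\<in>power2 ` {1..m}. real y / \<bar>a - real y\<bar>) = (\<Prod>i=1..m. (real i)\<^sup>2 / \<bar>a - (real i)\<^sup>2\<bar>)" for a
    by (subst prod.reindex[OF inj_power2_nat]) simp
  have "\<bar>coeff (base_poly m) 2\<bar> = 3 * (\<Prod>i=1..m. (real i)\<^sup>2 / \<bar>2 - (real i)\<^sup>2\<bar>)"
    using ni(1) re[of 2] N(1) by (subst coeff_base_poly) (auto simp: nodes_def)
  then show "\<bar>coeff (base_poly m) 2\<bar> \<le> 36"
    using prod_shifted_square_ratio_le[OF m, of 2] by simp
  have "\<bar>coeff (base_poly m) 3\<bar> = 2 * (\<Prod>i=1..m. (real i)\<^sup>2 / \<bar>3 - (real i)\<^sup>2\<bar>)"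
    using ni(2) re[of 3] N(2) by (subst coeff_base_poly) (auto simp: nodes_def)
  then show "\<bar>coeff (base_poly m) 3\<bar> \<le> 24"
    using prod_shifted_square_ratio_le[OF m, of 3] by simp
qed

lemma pnorm_base_poly_le:
  assumes m: "2 \<le> m"
  shows "pnorm (\<lambda>i. 1 + real i) (base_poly m) \<le> 300"
proof -
  let ?t = "\<lambda>x. (1 + real x) * \<bar>coeff (base_poly m) x\<bar>"
  have "pnorm (\<lambda>i. 1 + real i) (base_poly m) = (\<Sum>x\<in>nodes m. ?t x)"
    by (rule pnorm_eq_sum) (auto simp: coeff_base_poly_outside)
  also have "\<dots> = (\<Sum>x\<in>{0, 2, 3}. ?t x) + (\<Sum>x\<in>power2 ` {1..m}. ?t x)"
    unfolding nodes_def 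
    by (intro sum.union_disjoint) auto
  also have "(\<Sum>x\<in>power2 ` {1..m}. ?t x) = (\<Sum>j=1..m. (1 + (real j)\<^sup>2) * \<bar>coeff (base_poly m) (j\<^sup>2)\<bar>)"
    by (subst sum.reindex[OF inj_power2_nat]) simp
  also have "\<dots> \<le> (\<Sum>j=1..m. (1 + (real j)\<^sup>2) * (12 / (\<bar>(real j)\<^sup>2 - 2\<bar> * \<bar>(real j)\<^sup>2 - 3\<bar>)))"
    by (intro sum_mono mult_left_mono coeff_base_poly_square) auto
  also have "\<dots> \<le> 60" by (rule sum_inverse_quartic_le)
  \<comment> \<open>The nodes 0, 2, 3 and the squares add up to at most 1 + 3 * 36 + 4 * 24 + 60 =
    265.\<close>
  finally show ?thesis using coeff_base_poly_2_3[OF m] by (simp add: coeff_base_poly_0)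
qed

lemma degree_base_poly:
  assumes m: "2 \<le> m"
  shows "degree (base_poly m) \<le> m\<^sup>2"
proof (rule degree_le, intro allI impI)
  fix i assume i: "m\<^sup>2 < i"
  have "2\<^sup>2 \<le> m\<^sup>2" using m by (intro power_mono) auto
  moreover have "j\<^sup>2 \<le> m\<^sup>2" if "j \<in> {1..m}" for j using that by (intro power_mono) auto
  ultimately have "i \<notin> nodes m" using i unfolding nodes_def by (auto simp del: power_mono_iff) (metis atLeastAtMost_iff le_antisym One_nat_def leD)
  then show "coeff (base_poly m) i = 0" by (rule coeff_base_poly_outside)
qed

text \<open>The \<open>m + 3\<close> nodes give a zero of order at least \<open>m + 2\<close> at 1,
  of which \<open>m\<close> are divided out. The coefficients of the quotient are bounded by 300
  times the binomial coefficient of \<open>m^2\<close> over \<open>m\<close>, which is at most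
  \<open>(e m)^m\<close>.\<close>

lemma base_poly_quotient:
  assumes m: "3 \<le> m"
  obtains g where "base_poly m = [:1, -1:] ^ m * g" "degree g + m \<le> m\<^sup>2"
    "pnorm (\<lambda>_. 1) g \<le> (100 * real m) ^ m"
proof -
  have "[:-1, 1:] ^ m dvd dd_poly (nodes m)"
    using dd_poly_vanishing[of "nodes m" "m + 2"] card_nodes[of m]
    by (metis (no_types, lifting) add_Suc_right dvd_trans le_add1 le_imp_power_dvd numeral_2_eq_2 numeral_3_eq_3)
  then have "[:-1, 1:] ^ m dvd base_poly m" unfolding base_poly_def by (rule dvd_smult)
  moreover have "([:1, -1:] :: real poly) ^ m = smult ((-1) ^ m) ([:-1, 1:] ^ m)"
  proof -
    have "([:1, -1:] :: real poly) = smult (-1) [:-1, 1:]" by simp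
    then show ?thesis by (simp only: smult_power)
  qed
  ultimately have "[:1, -1:] ^ m dvd base_poly m" by (simp add: smult_dvd_iff)
  then obtain g where g: "base_poly m = [:1, -1:] ^ m * g" by (elim dvdE)
  have nz: "base_poly m \<noteq> 0" using coeff_base_poly_0[of m] by auto
  then have g0: "g \<noteq> 0" using g by auto
  have "degree (base_poly m) = m + degree g"
    unfolding g using g0 by (subst degree_mult_eq) (auto simp: degree_power_eq)
  then have dg: "degree g + m \<le> m\<^sup>2" using degree_base_poly[of m] m by simp
  have fn: "pnorm (\<lambda>_. 1) (base_poly m) \<le> 300"
  proof -
    have "pnorm (\<lambda>_. 1) (base_poly m) \<le> pnorm (\<lambda>i. 1 + real i) (base_poly m)"
      unfolding pnorm_def by (intro sum_mono mult_right_mono) auto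
    then show ?thesis using pnorm_base_poly_le[of m] m by simp
  qed
  have ch: "real ((m\<^sup>2) choose m) \<le> (3 * real m) ^ m"
  proof -
    have "real ((m\<^sup>2) choose m) \<le> real (m\<^sup>2) ^ m / fact m"
    proof -
      have "real (((m\<^sup>2) choose m) * fact m) \<le> real ((m\<^sup>2) ^ m)"
        by (simp only: of_nat_le_iff binomial_fact_pow)
      then show ?thesis by (simp add: pos_le_divide_eq)
    qed
    also have "\<dots> = real m ^ m * (real m ^ m / fact m)"
      by (simp add: power2_eq_square power_mult_distrib)
    also have "real m ^ m / fact m \<le> exp (real m)"
    proof -
      have s: "(\<lambda>n. real m ^ n /\<^sub>R fact n) sums exp (real m)" by (rule exp_converges)
      have "(\<Sum>n\<in>{m}. real m ^ n /\<^sub>R fact n) \<le> exp (real m)"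
        using s by (intro sum_le_suminf[of "\<lambda>n. real m ^ n /\<^sub>R fact n", THEN order_trans])
          (auto simp: sums_iff)
      then show ?thesis by (simp add: divide_inverse mult.commute)
    qed
    also have "exp (real m) \<le> 3 ^ m"
      using exp_le by (simp add: exp_of_nat_mult[of m "1::real", simplified] power_mono)
    finally have "real ((m\<^sup>2) choose m) \<le> real m ^ m * 3 ^ m" by (simp add: mult_left_mono)
    then show ?thesis by (simp add: power_mult_distrib mult.commute)
  qed
  have "pnorm (\<lambda>_. 1) g \<le> (\<Sum>i\<le>degree g. 300 * (3 * real m) ^ m)"
    unfolding pnorm_def
  proof (rule sum_mono)
    fix i assume "i \<in> {..degree g}"
    then have "i + m \<le> m\<^sup>2" using dg by simp
    then have "real ((i + m) choose m) \<le> real ((m\<^sup>2) choose m)"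
      by (simp add: binomial_right_mono)
    then have "real ((i + m) choose m) \<le> (3 * real m) ^ m" using ch by linarith
    then show "1 * \<bar>coeff g i\<bar> \<le> 300 * (3 * real m) ^ m"
      using order_trans[OF coeff_quotient_le[OF g, of i] mult_mono[OF fn]] by simp
  qed
  also have "\<dots> = real (Suc (degree g)) * (300 * (3 * real m) ^ m)" by simp
  \<comment> \<open>\<open>4^m\<close> pays for the number of coefficients and \<open>7^m\<close>
    for the factor 300, as \<open>m\<close> is at least 3.\<close>
  also have "\<dots> \<le> 4 ^ m * (7 ^ m * (3 * real m) ^ m)"
  proof (intro mult_mono mult_right_mono)
    have "m < 2 ^ m" by (rule less_exp)
    then have "m\<^sup>2 \<le> (2 ^ m)\<^sup>2" by (intro power_mono) auto
    also have "(2 ^ m)\<^sup>2 = (2\<^sup>2 :: nat) ^ m" by (simp only: power_mult[symmetric] mult.commute)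
    also have "\<dots> = 4 ^ m" by simp
    finally have "Suc (degree g) \<le> 4 ^ m" using dg m by linarith
    then show "real (Suc (degree g)) \<le> 4 ^ m" by (metis of_nat_le_iff of_nat_numeral of_nat_power)
    have "(300::real) \<le> 7 ^ 3" by simp
    also have "\<dots> \<le> 7 ^ m" using m by (intro power_increasing) auto
    finally show "(300::real) \<le> 7 ^ m" .
  qed auto
  also have "\<dots> = (84 * real m) ^ m" by (simp only: power_mult_distrib[symmetric]) simp
  also have "\<dots> \<le> (100 * real m) ^ m" by (intro power_mono) auto
  finally show ?thesis using that g dg by blast
qed

section \<open>Independent identically distributed lists\<close>

definition prob_weights :: "nat \<Rightarrow> (nat \<Rightarrow> real) \<Rightarrow> bool" where
  "prob_weights M w \<longleftrightarrow> (\<forall>u. 0 \<le> w u) \<and> (\<Sum>u\<le>M. w u) = 1"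

text \<open>The expectation under the product of \<open>N\<close> copies of \<open>w\<close>, peeled
  off coordinate by coordinate so that its properties follow by induction.\<close>

fun iid_mean :: "nat \<Rightarrow> (nat \<Rightarrow> real) \<Rightarrow> nat \<Rightarrow> (nat list \<Rightarrow> real) \<Rightarrow> real" where
  "iid_mean M w 0 F = F []"
| "iid_mean M w (Suc N) F = (\<Sum>u\<le>M. w u * iid_mean M w N (\<lambda>l. F (u # l)))"

lemma iid_mean_mono:
  assumes "prob_weights M w" "\<And>l. length l = N \<Longrightarrow> F l \<le> G l"
  shows "iid_mean M w N F \<le> iid_mean M w N G"
  using assms(2)
  by (induction N arbitrary: F G)
    (auto intro!: sum_mono mult_left_mono simp: assms(1)[unfolded prob_weights_def])

lemma iid_mean_add: "iid_mean M w N (\<lambda>l. F l + G l) = iid_mean M w N F + iid_mean M w N G"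
  by (induction N arbitrary: F G) (simp_all add: sum.distrib distrib_left)

lemma iid_mean_cmult: "iid_mean M w N (\<lambda>l. c * F l) = c * iid_mean M w N F"
  by (induction N arbitrary: F) (simp_all add: sum_distrib_left mult_ac)

lemma iid_mean_const: "prob_weights M w \<Longrightarrow> iid_mean M w N (\<lambda>_. c) = c"
  by (induction N) (simp_all add: prob_weights_def sum_distrib_right[symmetric])

lemma iid_mean_sum: "iid_mean M w N (\<lambda>l. \<Sum>x\<le>(K::nat). F x l) = (\<Sum>x\<le>K. iid_mean M w N (F x))"
  by (induction K) (simp_all add: iid_mean_add)

lemma iid_mean_prod: "iid_mean M w N (\<lambda>l. \<Prod>x\<leftarrow>l. b x) = (\<Sum>u\<le>M. w u * b u) ^ N"
  by (induction N) (simp_all add: iid_mean_cmult sum_distrib_left sum_distrib_right mult_ac)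

lemma iid_mean_abs_le:
  assumes "prob_weights M w" "\<And>l. length l = N \<Longrightarrow> \<bar>F l\<bar> \<le> G l"
  shows "\<bar>iid_mean M w N F\<bar> \<le> iid_mean M w N G"
proof -
  have "iid_mean M w N F \<le> iid_mean M w N G" "iid_mean M w N (\<lambda>l. (-1) * F l) \<le> iid_mean M w N G"
    using assms(2) by (intro iid_mean_mono[OF assms(1)]; force simp: abs_le_iff)+
  then show ?thesis unfolding iid_mean_cmult by (simp add: abs_le_iff)
qed

text \<open>Lindeberg's exchange argument: the weights are replaced one coordinate at a time.\<close>

lemma iid_mean_exchange:
  assumes P: "prob_weights M P" and Q: "prob_weights M Q"
    and b: "\<And>u. 0 \<le> b u" and \<rho>: "1 \<le> \<rho>" "(\<Sum>u\<le>M. P u * b u) \<le> \<rho>" "(\<Sum>u\<le>M. Q u * b u) \<le> \<rho>"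
    and "0 \<le> \<epsilon>" "0 \<le> \<kappa>"
    and step: "\<And>l1 l2. Suc (length l1 + length l2) = N \<Longrightarrow>
      \<bar>\<Sum>u\<le>M. (P u - Q u) * F (l1 @ u # l2)\<bar> \<le> \<epsilon> + \<kappa> * (\<Prod>x\<leftarrow>l1 @ l2. b x)"
  shows "\<bar>iid_mean M P N F - iid_mean M Q N F\<bar> \<le> real N * (\<epsilon> + \<kappa> * \<rho> ^ N)"
  using assms(8-)
\<comment> \<open>\<open>\<kappa>\<close> has to vary: fixing the first entry \<open>u\<close>
  replaces it by \<open>\<kappa> * b u\<close>.\<close>
proof (induction N arbitrary: F \<kappa>)
  case 0
  then show ?case by simp
next
  case (Suc N)
  \<comment> \<open>\<open>?A\<close> exchanges the later entries while the first one follows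
    \<open>P\<close>; \<open>?B\<close> exchanges the first entry while the later ones follow
    \<open>Q\<close>.\<close>
  let ?A = "\<Sum>u\<le>M. P u * (iid_mean M P N (\<lambda>l. F (u # l)) - iid_mean M Q N (\<lambda>l. F (u # l)))"
  let ?B = "\<Sum>u\<le>M. (P u - Q u) * iid_mean M Q N (\<lambda>l. F (u # l))"
  have split: "iid_mean M P (Suc N) F - iid_mean M Q (Suc N) F = ?A + ?B"
    by (simp add: sum_subtractf[symmetric] sum.distrib[symmetric] algebra_simps)
  have P0: "0 \<le> P u" and P1: "(\<Sum>u\<le>M. P u) = 1" for u using P by (auto simp: prob_weights_def)
  have "\<bar>?A\<bar> \<le> (\<Sum>u\<le>M. P u * (real N * (\<epsilon> + \<kappa> * b u * \<rho> ^ N)))"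
  proof (intro order_trans[OF sum_abs] sum_mono)
    fix u
    have "\<bar>iid_mean M P N (\<lambda>l. F (u # l)) - iid_mean M Q N (\<lambda>l. F (u # l))\<bar>
        \<le> real N * (\<epsilon> + \<kappa> * b u * \<rho> ^ N)"
    proof (rule Suc.IH)
      show "0 \<le> \<kappa> * b u" using Suc.prems(1) b by simp
      fix l1 l2 :: "nat list" assume "Suc (length l1 + length l2) = N"
      then show "\<bar>\<Sum>v\<le>M. (P v - Q v) * F (u # l1 @ v # l2)\<bar> \<le> \<epsilon> + \<kappa> * b u * (\<Prod>x\<leftarrow>l1 @ l2. b x)"
        using Suc.prems(2)[of "u # l1" l2] by (simp add: mult_ac)
    qed
    then show "\<bar>P u * (iid_mean M P N (\<lambda>l. F (u # l)) - iid_mean M Q N (\<lambda>l. F (u # l)))\<bar>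
        \<le> P u * (real N * (\<epsilon> + \<kappa> * b u * \<rho> ^ N))"
      using P0 by (simp add: abs_mult mult_left_mono)
  qed
  also have "\<dots> = real N * ((\<Sum>u\<le>M. P u) * \<epsilon> + \<kappa> * \<rho> ^ N * (\<Sum>u\<le>M. P u * b u))"
    by (simp add: sum_distrib_left sum_distrib_right sum.distrib algebra_simps)
  also have "\<dots> \<le> real N * (\<epsilon> + \<kappa> * \<rho> ^ N * \<rho>)"
    unfolding P1 using \<rho> Suc.prems(1) by (intro mult_left_mono add_mono) auto
  finally have A: "\<bar>?A\<bar> \<le> real N * (\<epsilon> + \<kappa> * \<rho> ^ Suc N)" by (simp add: mult_ac)
  have "?B = iid_mean M Q N (\<lambda>l. \<Sum>u\<le>M. (P u - Q u) * F (u # l))"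
    by (simp add: iid_mean_sum iid_mean_cmult)
  also have "\<bar>\<dots>\<bar> \<le> iid_mean M Q N (\<lambda>l. \<epsilon> + \<kappa> * (\<Prod>x\<leftarrow>l. b x))"
    using Suc.prems(2)[of "[]"] by (intro iid_mean_abs_le[OF Q]) simp
  also have "\<dots> = \<epsilon> + \<kappa> * (\<Sum>u\<le>M. Q u * b u) ^ N"
    by (simp add: iid_mean_add iid_mean_cmult iid_mean_const[OF Q] iid_mean_prod)
  also have "\<dots> \<le> \<epsilon> + \<kappa> * \<rho> ^ N"
    using \<rho> Q b Suc.prems(1)
    by (intro add_mono mult_left_mono power_mono order_refl sum_nonneg) (auto simp: prob_weights_def)
  also have "\<dots> \<le> \<epsilon> + \<kappa> * \<rho> ^ Suc N"
    using \<rho>(1) Suc.prems(1) by (intro add_mono mult_left_mono power_increasing) auto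
  finally have B: "\<bar>?B\<bar> \<le> \<epsilon> + \<kappa> * \<rho> ^ Suc N" .
  have "\<bar>?A + ?B\<bar> \<le> real N * (\<epsilon> + \<kappa> * \<rho> ^ Suc N) + (\<epsilon> + \<kappa> * \<rho> ^ Suc N)"
    using A B by linarith
  then show ?case unfolding split by (simp add: algebra_simps)
qed

section \<open>An exponential moment bound\<close>

text \<open>For negative \<open>x\<close> the quadratic Taylor lower bound of
  \<open>exp (- x)\<close> is inverted; its product with the claimed bound is at least 1.\<close>

lemma exp_le_quadratic:
  fixes x :: real
  assumes "x \<le> 1"
  shows "exp x \<le> 1 + x + x\<^sup>2"
proof (cases "0 \<le> x")
  case True
  then show ?thesis using exp_bound assms by blast
next
  case False
  have "exp (- x) \<ge> 1 + (- x) + (- x)\<^sup>2 / 2"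
    using exp_lower_Taylor_quadratic[of "- x"] False by simp
  then have "exp (- x) \<ge> 1 - x + x\<^sup>2 / 2" by simp
  moreover have "1 - x + x\<^sup>2 / 2 > 0" using False zero_le_power2[of x] by linarith
  ultimately have "exp x \<le> 1 / (1 - x + x\<^sup>2 / 2)"
    by (simp add: exp_minus field_simps)
  also have "\<dots> \<le> 1 + x + x\<^sup>2"
  proof -
    have "(1 + x + x\<^sup>2) * (1 - x + x\<^sup>2 / 2) = 1 + (x\<^sup>2 + - x * x\<^sup>2 + (x\<^sup>2)\<^sup>2) / 2"
      by (simp add: power2_eq_square field_simps)
    also have "\<dots> \<ge> 1" using False mult_nonneg_nonneg[of "- x" "x\<^sup>2"] by simp
    finally show ?thesis using \<open>1 - x + x\<^sup>2 / 2 > 0\<close> by (simp add: divide_simps)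
  qed
  finally show ?thesis .
qed

text \<open>The Chernoff bound: by independence the mean is a power, and in each factor the linear
  term vanishes because \<open>q\<close> is the mean of \<open>B\<close>, leaving at most
  \<open>1 + s^2\<close>.\<close>

lemma iid_mean_exp_centered_le:
  assumes w: "prob_weights M w" and B: "\<And>u. 0 \<le> B u \<and> B u \<le> 1" and s: "\<bar>s\<bar> \<le> 1"
    and q: "q = (\<Sum>u\<le>M. w u * B u)"
  shows "iid_mean M w N (\<lambda>l. exp (s * ((\<Sum>x\<leftarrow>l. B x) - real N * q))) \<le> exp (real N * s\<^sup>2)"
proof -
  have w0: "0 \<le> w u" and w1: "(\<Sum>u\<le>M. w u) = 1" for u using w by (auto simp: prob_weights_def)
  have q01: "0 \<le> q" "q \<le> 1"
  proof -
    show "0 \<le> q" unfolding q using w0 B by (intro sum_nonneg) auto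
    have "q \<le> (\<Sum>u\<le>M. w u * 1)" unfolding q using w0 B by (intro sum_mono mult_left_mono) auto
    then show "q \<le> 1" using w1 by simp
  qed
  have e: "exp (s * ((\<Sum>x\<leftarrow>l. B x) - real (length l) * q)) = (\<Prod>x\<leftarrow>l. exp (s * (B x - q)))" for l
  proof (induction l)
    case (Cons a l)
    have "s * ((\<Sum>x\<leftarrow>a # l. B x) - real (length (a # l)) * q)
        = s * (B a - q) + s * ((\<Sum>x\<leftarrow>l. B x) - real (length l) * q)"
      by (simp add: algebra_simps)
    then show ?case using Cons by (simp add: exp_add)
  qed simp
  have "iid_mean M w N (\<lambda>l. exp (s * ((\<Sum>x\<leftarrow>l. B x) - real N * q)))
      \<le> iid_mean M w N (\<lambda>l. \<Prod>x\<leftarrow>l. exp (s * (B x - q)))"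
    by (intro iid_mean_mono[OF w]) (simp only: e[symmetric])
  also have "\<dots> = (\<Sum>u\<le>M. w u * exp (s * (B u - q))) ^ N" by (rule iid_mean_prod)
  also have "\<dots> \<le> (exp (s\<^sup>2)) ^ N"
  proof (rule power_mono)
    have "(\<Sum>u\<le>M. w u * exp (s * (B u - q))) \<le> (\<Sum>u\<le>M. w u * (1 + s * (B u - q) + s\<^sup>2))"
    proof (intro sum_mono mult_left_mono w0)
      fix u
      have bq: "\<bar>B u - q\<bar> \<le> 1" using B[of u] q01 by (auto simp: abs_le_iff)
      then have "\<bar>s * (B u - q)\<bar> \<le> \<bar>s\<bar> * 1" unfolding abs_mult by (intro mult_left_mono) auto
      then have le: "\<bar>s * (B u - q)\<bar> \<le> \<bar>s\<bar>" by simp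
      then have "(s * (B u - q))\<^sup>2 \<le> s\<^sup>2" by (simp only: abs_le_square_iff)
      then show "exp (s * (B u - q)) \<le> 1 + s * (B u - q) + s\<^sup>2"
        using exp_le_quadratic[of "s * (B u - q)"] le s by linarith
    qed
    also have "\<dots> = (\<Sum>u\<le>M. w u) * (1 - s * q + s\<^sup>2) + s * (\<Sum>u\<le>M. w u * B u)"
      by (simp add: sum_distrib_left sum_distrib_right sum.distrib[symmetric] algebra_simps)
    also have "\<dots> = 1 + s\<^sup>2" unfolding w1 q[symmetric] by simp
    also have "\<dots> \<le> exp (s\<^sup>2)" by (rule exp_ge_add_one_self)
    finally show "(\<Sum>u\<le>M. w u * exp (s * (B u - q))) \<le> exp (s\<^sup>2)" .
  qed (use w0 in \<open>auto intro: sum_nonneg\<close>)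
  finally show ?thesis by (simp add: exp_of_nat_mult)
qed

section \<open>Random urns\<close>

fun slots :: "nat \<Rightarrow> nat list \<Rightarrow> nat list" where
  "slots i [] = []"
| "slots i (u # l) = replicate u i @ slots (Suc i) l"

text \<open>The last colour \<open>length l\<close> fills the urn up; the subtraction truncates when \<open>l\<close> asks for
  more than \<open>k\<close> balls.\<close>

definition urn :: "nat \<Rightarrow> nat list \<Rightarrow> nat list" where
  "urn k l = slots 0 l @ replicate (k - sum_list l) (length l)"

lemma length_slots [simp]: "length (slots i l) = sum_list l"
  by (induction l arbitrary: i) auto

lemma slots_append: "slots i (l1 @ l2) = slots i l1 @ slots (i + length l1) l2"
  by (induction l1 arbitrary: i) auto

lemma set_slots_subset: "set (slots i l) \<subseteq> {i..<i + length l}"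
  by (induction l arbitrary: i) (force split: if_splits)+

lemma card_set_slots: "card (set (slots i l)) = length (filter (\<lambda>u. 0 < u) l)"
proof (induction l arbitrary: i)
  case (Cons u l)
  have "i \<notin> set (slots (Suc i) l)" using set_slots_subset[of "Suc i" l] by auto
  then show ?case using Cons by (cases u) (auto simp: set_replicate_conv_if)
qed simp

lemma length_urn: "sum_list l \<le> k \<Longrightarrow> length (urn k l) = k"
  by (simp add: urn_def)

text \<open>Each nonempty slot has its own colour; the possible extra colour is the one that fills
  up the urn.\<close>

lemma num_colors_urn:
  assumes "sum_list l \<le> k"
  shows "length (filter (\<lambda>u. 0 < u) l) \<le> num_colors k ((!) (urn k l))"
    "num_colors k ((!) (urn k l)) \<le> length (filter (\<lambda>u. 0 < u) l) + 1"
proof -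
  have "(!) (urn k l) ` {..<k} = set (urn k l)"
    using length_urn[OF assms] by (auto simp: set_conv_nth)
  then have nc: "num_colors k ((!) (urn k l)) = card (set (urn k l))" by (simp add: num_colors_def)
  have s1: "set (slots 0 l) \<subseteq> set (urn k l)"
    and s2: "set (urn k l) \<subseteq> insert (length l) (set (slots 0 l))"
    by (auto simp: urn_def split: if_splits)
  show "length (filter (\<lambda>u. 0 < u) l) \<le> num_colors k ((!) (urn k l))"
    using card_mono[OF _ s1] by (simp add: nc card_set_slots)
  have "card (set (urn k l)) \<le> card (insert (length l) (set (slots 0 l)))"
    using card_mono[OF _ s2] by simp
  also have "\<dots> \<le> card (set (slots 0 l)) + 1" by (simp add: card_insert_if)
  finally show "num_colors k ((!) (urn k l)) \<le> length (filter (\<lambda>u. 0 < u) l) + 1"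
    by (simp add: nc card_set_slots)
qed

section \<open>Exchanging the number of balls in one slot\<close>

lemma sum_coeff_mult:
  fixes p q :: "real poly" and h :: "nat \<Rightarrow> real"
  assumes "degree p + degree q \<le> M"
  shows "(\<Sum>u\<le>M. coeff (p * q) u * h u)
       = (\<Sum>i\<le>degree p. \<Sum>j\<le>degree q. coeff p i * coeff q j * h (i + j))"
proof -
  have "p * q = (\<Sum>i\<le>degree p. \<Sum>j\<le>degree q. monom (coeff p i * coeff q j) (i + j))"
    unfolding mult_monom[symmetric] sum_product[symmetric] poly_as_sum_of_monoms ..
  then have "(\<Sum>u\<le>M. coeff (p * q) u * h u)
      = (\<Sum>u\<le>M. \<Sum>i\<le>degree p. \<Sum>j\<le>degree q. (if i + j = u then coeff p i * coeff q j * h u else 0))"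
    by (simp only: coeff_sum coeff_monom sum_distrib_right) (intro sum.cong refl, auto)
  also have "\<dots> = (\<Sum>i\<le>degree p. \<Sum>j\<le>degree q. \<Sum>u\<le>M. (if i + j = u then coeff p i * coeff q j * h u else 0))"
    by (rule trans[OF sum.swap]) (intro sum.cong refl sum.swap)
  also have "\<dots> = (\<Sum>i\<le>degree p. \<Sum>j\<le>degree q. coeff p i * coeff q j * h (i + j))"
    using assms by (intro sum.cong refl) (simp add: sum.delta)
  finally show ?thesis .
qed

lemma coeff_one_minus_X_power: "coeff ([:1, -1:] ^ L) e = (-1) ^ e * real (L choose e)"
proof (induction L arbitrary: e)
  case 0
  then show ?case by (cases e) auto
next
  case (Suc L)
  then show ?case by (cases e) (auto simp: algebra_simps)
qed

lemma sum_Pow_card: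
  fixes h :: "nat \<Rightarrow> real"
  shows "(\<Sum>E\<in>Pow {..<L}. (-1) ^ card E * h (card E)) = (\<Sum>e\<le>L. (-1) ^ e * real (L choose e) * h e)"
proof -
  have "card ` Pow {..<L} \<subseteq> {..L}"
    using card_mono[of "{..<L}"] by fastforce
  then have "(\<Sum>E\<in>Pow {..<L}. (-1) ^ card E * h (card E))
      = (\<Sum>e\<le>L. \<Sum>E\<in>{E \<in> Pow {..<L}. card E = e}. (-1) ^ card E * h (card E))"
    by (intro sum.group[symmetric]) auto
  also have "\<dots> = (\<Sum>e\<le>L. (-1) ^ e * real (L choose e) * h e)"
    by (intro sum.cong refl) (simp add: n_subsets)
  finally show ?thesis .
qed

lemma mset_two_colour_list:
  assumes "E \<subseteq> {..<L}"
  shows "mset (map (\<lambda>j. if j \<in> E then z else w) [0..<L])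
       = replicate_mset (card E) z + replicate_mset (L - card E) w"
proof -
  have "{x. x \<in> E \<and> x < L} = E" "{x. x \<notin> E \<and> x < L} = {..<L} - E" using assms by auto
  moreover have "card ({..<L} - E) = L - card E"
    using assms by (subst card_Diff_subset) (auto intro: finite_subset)
  ultimately show ?thesis
    by (simp add: image_mset_If image_mset_const_eq filter_mset_mset_set conj_commute)
qed

text \<open>The sum is a combination, with the coefficients of \<open>g\<close>, of
  \<open>L\<close>-th finite differences of \<open>h\<close>. A slot with \<open>x + card E\<close>
  balls is realised by \<open>x\<close> fixed balls and \<open>L\<close> movable ones: those in
  \<open>E\<close> get the colour of the slot, the others the filling colour. This makes the
  difference an alternating sum over recolourings.\<close>

lemma exchange_one_slot:
  assumes ex: "exchangeable k n S" and nk: "n \<le> k" and phi: "\<And>l. \<bar>\<phi> l\<bar> \<le> 1"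
    and f: "f = [:1, -1:] ^ L * g" and deg: "degree g + L \<le> M"
    and room: "sum_list l1 + sum_list l2 + M \<le> k"
  shows "\<bar>\<Sum>u\<le>M. coeff f u * sample_mean S \<phi> (urn k (l1 @ u # l2))\<bar>
     \<le> (2 * real n / real k) ^ L * pnorm (\<lambda>_. 1) g"
proof -
  define h where "h u = sample_mean S \<phi> (urn k (l1 @ u # l2))" for u
  let ?z = "length l1" and ?w = "Suc (length l1 + length l2)"
  have diff: "\<bar>\<Sum>e\<le>L. (-1) ^ e * real (L choose e) * h (x + e)\<bar> \<le> (2 * real n / real k) ^ L"
    if x: "x \<le> degree g" for x
  proof -
    \<comment> \<open>The balls other than the \<open>L\<close> movable ones; they do not depend on
      \<open>E\<close>.\<close>
    define ys where "ys = slots 0 l1 @ replicate x ?z @ slots (Suc ?z) l2 @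
      replicate (k - sum_list l1 - sum_list l2 - x - L) ?w"
    have len: "L + length ys = k" unfolding ys_def using room x deg by simp
    have "h (x + card E) = sample_mean S \<phi> (map (\<lambda>j. if j \<in> E then ?z else ?w) [0..<L] @ ys)"
      if E: "E \<subseteq> {..<L}" for E
    proof -
      have cE: "card E \<le> L" using card_mono[OF _ E] by simp
      have "mset (urn k (l1 @ (x + card E) # l2))
          = mset (map (\<lambda>j. if j \<in> E then ?z else ?w) [0..<L] @ ys)"
      proof -
        have "k - (sum_list l1 + (x + card E + sum_list l2))
            = (L - card E) + (k - sum_list l1 - sum_list l2 - x - L)"
          using room x deg cE by simp
        then show ?thesis
          unfolding urn_def ys_def mset_append mset_two_colour_list[OF E]
          by (simp add: slots_append replicate_add ac_simps)
      qed
      moreover have "length (urn k (l1 @ (x + card E) # l2)) = k"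
        using room x deg cE by (intro length_urn) simp
      ultimately show ?thesis unfolding h_def by (intro sample_mean_mset_cong[OF ex])
    qed
    then have "(\<Sum>E\<in>Pow {..<L}. (-1) ^ card E * h (x + card E))
        = (\<Sum>E\<in>Pow {..<L}. (-1) ^ card E *
            sample_mean S \<phi> (map (\<lambda>j. if j \<in> E then ?z else ?w) [0..<L] @ ys))"
      by (intro sum.cong refl) auto
    then show ?thesis
      using alternating_sample_mean_le[OF ex nk len phi, where z = ?z and w = ?w] sum_Pow_card[where L = L and h = "\<lambda>e. h (x + e)"]
      by simp
  qed
  have dL: "degree ([:1, -1:] ^ L :: real poly) = L" by (simp add: degree_power_eq)
  have "(\<Sum>u\<le>M. coeff f u * h u)
      = (\<Sum>x\<le>degree g. \<Sum>e\<le>L. coeff g x * coeff ([:1, -1:] ^ L) e * h (x + e))"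
    unfolding f using deg sum_coeff_mult[of g "[:1, -1:] ^ L" M h] by (simp only: dL mult.commute[of _ g])
  also have "\<dots> = (\<Sum>x\<le>degree g. coeff g x * (\<Sum>e\<le>L. (-1) ^ e * real (L choose e) * h (x + e)))"
    by (simp add: coeff_one_minus_X_power sum_distrib_left mult_ac)
  finally have "\<bar>\<Sum>u\<le>M. coeff f u * h u\<bar>
      \<le> (\<Sum>x\<le>degree g. \<bar>coeff g x * (\<Sum>e\<le>L. (-1) ^ e * real (L choose e) * h (x + e))\<bar>)"
    using sum_abs by simp
  also have "\<dots> \<le> (\<Sum>x\<le>degree g. \<bar>coeff g x\<bar> * (2 * real n / real k) ^ L)"
    unfolding abs_mult[of "coeff g _"] by (intro sum_mono mult_left_mono diff) auto
  also have "\<dots> = (2 * real n / real k) ^ L * pnorm (\<lambda>_. 1) g"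
    by (simp add: pnorm_def sum_distrib_right mult.commute)
  finally show ?thesis by (simp add: h_def)
qed

section \<open>From estimators to tests\<close>

text \<open>Pointwise, 1 is at most \<open>\<phi>\<close> plus the indicator of failure; averaging
  over \<open>S\<close> gives the claim.\<close>

lemma sample_mean_ge_1_minus_fail_prob:
  assumes "finite S" "S \<noteq> {}" "\<And>ys. 0 \<le> \<phi> ys"
    and "\<And>ys. \<bar>real_of_int (est ys) - real (num_colors k ((!) xs))\<bar> < \<Delta> \<Longrightarrow> 1 \<le> \<phi> ys"
  shows "1 - fail_prob S k ((!) xs) est \<Delta> \<le> sample_mean S \<phi> xs"
proof -
  let ?fail = "\<lambda>s. \<Delta> \<le> \<bar>real_of_int (est (map ((!) xs) s)) - real (num_colors k ((!) xs))\<bar>"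
  have c: "0 < real (card S)" using assms(1,2) by (simp add: card_gt_0_iff)
  have "real (card S) = (\<Sum>s\<in>S. 1)" by simp
  also have "\<dots> \<le> (\<Sum>s\<in>S. \<phi> (map ((!) xs) s) + (if ?fail s then 1 else 0))"
  proof (rule sum_mono)
    fix s
    show "1 \<le> \<phi> (map ((!) xs) s) + (if ?fail s then 1 else 0)"
      using assms(3,4)[of "map ((!) xs) s"] by (auto simp: not_le)
  qed
  also have "\<dots> = (\<Sum>s\<in>S. \<phi> (map ((!) xs) s)) + real (card {s \<in> S. ?fail s})"
    using assms(1) by (simp add: sum.distrib sum.If_cases Int_def)
  finally have "1 \<le> ((\<Sum>s\<in>S. \<phi> (map ((!) xs) s)) + real (card {s \<in> S. ?fail s})) / real (card S)"
    using c by (simp add: pos_le_divide_eq)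
  then show ?thesis by (simp add: sample_mean_def fail_prob_def add_divide_distrib)
qed

lemma sample_mean_le_fail_prob:
  assumes "finite S" "\<And>ys. \<phi> ys \<le> 1"
    and "\<And>ys. \<bar>real_of_int (est ys) - real (num_colors k ((!) xs))\<bar> < \<Delta> \<Longrightarrow> \<phi> ys \<le> 0"
  shows "sample_mean S \<phi> xs \<le> fail_prob S k ((!) xs) est \<Delta>"
proof -
  let ?fail = "\<lambda>s. \<Delta> \<le> \<bar>real_of_int (est (map ((!) xs) s)) - real (num_colors k ((!) xs))\<bar>"
  have "(\<Sum>s\<in>S. \<phi> (map ((!) xs) s)) \<le> (\<Sum>s\<in>S. if ?fail s then 1 else 0)"
  proof (rule sum_mono)
    fix s
    show "\<phi> (map ((!) xs) s) \<le> (if ?fail s then 1 else 0)"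
      using assms(2,3)[of "map ((!) xs) s"] by (auto simp: not_le)
  qed
  also have "\<dots> = real (card {s \<in> S. ?fail s})"
    using assms(1) by (simp add: sum.If_cases Int_def)
  finally show ?thesis by (simp add: sample_mean_def fail_prob_def divide_right_mono)
qed

lemma sample_mean_bounds:
  assumes "\<And>ys. 0 \<le> \<phi> ys" "\<And>ys. \<phi> ys \<le> 1"
  shows "0 \<le> sample_mean S \<phi> xs" "sample_mean S \<phi> xs \<le> 1"
proof -
  show "0 \<le> sample_mean S \<phi> xs" unfolding sample_mean_def using assms by (simp add: sum_nonneg)
  have "(\<Sum>s\<in>S. \<phi> (map ((!) xs) s)) \<le> (\<Sum>s\<in>S. 1)" using assms by (intro sum_mono)
  then show "sample_mean S \<phi> xs \<le> 1"
    unfolding sample_mean_def by (cases "card S = 0") (auto simp: pos_divide_le_eq)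
qed

section \<open>The two weight functions\<close>

text \<open>For \<open>\<sigma> = 1\<close> and \<open>\<sigma> = -1\<close> these are the positive and the negative part of \<open>f / D\<close> away from 0,
  with the remaining mass put at 0.\<close>

definition half_weights :: "real poly \<Rightarrow> nat \<Rightarrow> real \<Rightarrow> real \<Rightarrow> nat \<Rightarrow> real" where
  "half_weights f M D \<sigma> u =
     (if u = 0 then 1 - (\<Sum>x=1..M. max (\<sigma> * coeff f x) 0) / D else max (\<sigma> * coeff f u) 0 / D)"

lemma atMost_insert_0: "{..M} = insert 0 {1..(M::nat)}"
  by auto

context
  fixes f :: "real poly" and M :: nat and K \<sigma> :: real
  assumes deg: "degree f \<le> M" and norm: "pnorm (\<lambda>i. 1 + real i) f \<le> K" and K: "0 < K"
    and \<sigma>: "\<bar>\<sigma>\<bar> = 1"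
begin

lemma sum_max_coeff_le: "(\<Sum>x=1..M. (1 + real x) * max (\<sigma> * coeff f x) 0) \<le> K"
proof -
  have "(\<Sum>x=1..M. (1 + real x) * max (\<sigma> * coeff f x) 0) \<le> (\<Sum>x=1..M. (1 + real x) * \<bar>coeff f x\<bar>)"
  proof (intro sum_mono mult_left_mono)
    fix x
    have "\<bar>\<sigma> * coeff f x\<bar> = \<bar>coeff f x\<bar>" using \<sigma> by (simp add: abs_mult)
    then show "max (\<sigma> * coeff f x) 0 \<le> \<bar>coeff f x\<bar>" by linarith
  qed auto
  also have "\<dots> \<le> (\<Sum>x\<le>M. (1 + real x) * \<bar>coeff f x\<bar>)" by (intro sum_mono2) auto
  also have "\<dots> = pnorm (\<lambda>i. 1 + real i) f" using pnorm_eq_sum_atMost[OF deg] by simp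
  finally show ?thesis using norm by simp
qed

text \<open>The mass away from 0 is at most \<open>K / (8 * K)\<close>, so a nonnegative mass
  remains for 0.\<close>

lemma prob_weights_half_weights: "prob_weights M (half_weights f M (8 * K) \<sigma>)"
proof -
  have "(\<Sum>x=1..M. max (\<sigma> * coeff f x) 0) \<le> (\<Sum>x=1..M. (1 + real x) * max (\<sigma> * coeff f x) 0)"
  proof (rule sum_mono)
    fix x
    show "max (\<sigma> * coeff f x) 0 \<le> (1 + real x) * max (\<sigma> * coeff f x) 0"
      using mult_right_mono[of 1 "1 + real x" "max (\<sigma> * coeff f x) 0"] by simp
  qed
  then have "(\<Sum>x=1..M. max (\<sigma> * coeff f x) 0) \<le> K" using sum_max_coeff_le by linarith
  then have "(\<Sum>x=1..M. max (\<sigma> * coeff f x) 0) / (8 * K) \<le> 1" using K by (simp add: pos_divide_le_eq)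
  then show ?thesis
    using K unfolding prob_weights_def atMost_insert_0
    by (auto simp: half_weights_def sum_divide_distrib intro!: divide_nonneg_pos)
qed

text \<open>On the unit interval \<open>exp t\<close> is at most \<open>1 + 2 t\<close>, and the
  mean number of balls in a slot is at most 1/8 by the weighted norm.\<close>

lemma sum_half_weights_exp_le:
  assumes M: "1 \<le> M"
  shows "(\<Sum>u\<le>M. half_weights f M (8 * K) \<sigma> u * exp (real u / real M)) \<le> 1 + 1 / (4 * real M)"
proof -
  let ?w = "half_weights f M (8 * K) \<sigma>"
  have w: "0 \<le> ?w u" "(\<Sum>u\<le>M. ?w u) = 1" for u
    using prob_weights_half_weights by (auto simp: prob_weights_def)
  have "(\<Sum>u\<le>M. ?w u * exp (real u / real M)) \<le> (\<Sum>u\<le>M. ?w u * (1 + 2 * (real u / real M)))"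
  proof (intro sum_mono mult_left_mono w)
    fix u assume "u \<in> {..M}"
    then have x: "0 \<le> real u / real M" "real u / real M \<le> 1" using M by auto
    then have "(real u / real M)\<^sup>2 \<le> real u / real M"
      unfolding power2_eq_square using mult_left_le by blast
    then show "exp (real u / real M) \<le> 1 + 2 * (real u / real M)"
      using exp_le_quadratic[OF x(2)] by linarith
  qed
  also have "\<dots> = 1 + 2 / real M * (\<Sum>u\<le>M. ?w u * real u)"
  proof -
    have "?w u * (1 + 2 * (real u / real M)) = ?w u + 2 / real M * (?w u * real u)" for u
      by (simp add: distrib_left)
    then show ?thesis by (simp only: sum.distrib sum_distrib_left[symmetric] w(2))
  qed
  also have "(\<Sum>u\<le>M. ?w u * real u) = (\<Sum>u=1..M. ?w u * real u)"
    unfolding atMost_insert_0 by simp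
  also have "\<dots> \<le> (\<Sum>u=1..M. (1 + real u) * max (\<sigma> * coeff f u) 0) / (8 * K)"
    unfolding sum_divide_distrib
    using K by (intro sum_mono) (auto simp: half_weights_def divide_right_mono mult_ac intro!: divide_right_mono mult_right_mono)
  also have "\<dots> \<le> K / (8 * K)" using sum_max_coeff_le K by (intro divide_right_mono) auto
  also have "\<dots> = 1 / 8" using K by simp
  finally show ?thesis using M by (simp add: mult_left_mono field_simps)
qed

end

text \<open>Only \<open>u = 0\<close> needs the zero at 1: the coefficients sum to 0, so the
  remaining masses differ by the constant coefficient over \<open>D\<close>.\<close>

lemma half_weights_diff:
  assumes "degree f \<le> M" "poly f 1 = 0" "u \<le> M"
  shows "half_weights f M D 1 u - half_weights f M D (-1) u = coeff f u / D"
proof -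
  have mx: "max (1 * x) 0 - max (-1 * x) 0 = x" for x :: real by (simp add: max_def)
  have "(\<Sum>x\<le>M. coeff f x) = 0"
  proof -
    have "(\<Sum>x\<le>M. coeff f x) = (\<Sum>x\<le>degree f. coeff f x)"
      using assms(1) by (intro sum.mono_neutral_right) (auto simp: coeff_eq_0)
    then show ?thesis using assms(2) by (simp add: poly_altdef)
  qed
  then have "(\<Sum>x=1..M. coeff f x) = - coeff f 0" unfolding atMost_insert_0 by simp
  then have "(\<Sum>x=1..M. max (1 * coeff f x) 0) - (\<Sum>x=1..M. max (-1 * coeff f x) 0) = - coeff f 0"
    unfolding sum_subtractf[symmetric] mx .
  then show ?thesis
    using mx[of "coeff f u"] by (cases "u = 0") (simp_all add: half_weights_def diff_divide_distrib[symmetric])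
qed

section \<open>The lower bound\<close>

lemma prod_list_exp: "(\<Prod>x\<leftarrow>l. exp (real x / c)) = exp (real (sum_list l) / c)"
  by (induction l) (simp_all add: exp_add add_divide_distrib)

text \<open>Le Cam's two-point method with random urns. An estimator that is good on every urn
  yields a threshold test whose mean is at least 8/10 under \<open>P\<close> and at most 3/20 under
  \<open>Q\<close>, although the exchange argument bounds the difference by 1/10.\<close>

lemma exists_urn_with_large_fail_prob:
  fixes K G \<Delta> :: real
  assumes ex: "exchangeable k n S" and S: "S \<noteq> {}" and nk: "n \<le> k"
    and f: "f = [:1, -1:] ^ L * g" and deg: "degree f \<le> M" "degree g + L \<le> M"
    and L: "1 \<le> L" and M: "1 \<le> M"
    and f0: "coeff f 0 = 1" and norm: "pnorm (\<lambda>i. 1 + real i) f \<le> K" and K: "1 \<le> K"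
    and gnorm: "pnorm (\<lambda>_. 1) g \<le> G"
    and small: "real k * ((2 * real n / real k) ^ L * G + exp (1 - 3 * real k / (4 * real M))) \<le> 1 / 10"
    and tailT: "exp (- (3 * real k / (4 * real M))) \<le> 1 / 20"
    and \<Delta>: "1 \<le> \<Delta>" "64 * K * \<Delta> \<le> real k"
    and tailY: "exp (- (real k / (4096 * K\<^sup>2))) \<le> 1 / 20"
  shows "\<exists>u. fail_prob S k u est \<Delta> > 1 / 10"
proof (rule ccontr)
  assume "\<not> ?thesis"
  then have good: "fail_prob S k u est \<Delta> \<le> 1 / 10" for u by (simp add: not_less)
  define P where "P = half_weights f M (8 * K) 1"
  define Q where "Q = half_weights f M (8 * K) (-1)"
  define \<rho> where "\<rho> = 1 + 1 / (4 * real M)"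
  define b where "b u = exp (real u / real M)" for u :: nat
  \<comment> \<open>\<open>\<delta>\<close> is the gap \<open>P 0 - Q 0\<close>, so the expected
    numbers of nonempty slots differ by \<open>k \<delta> = 4 a\<close>, with \<open>Q\<close>
    having more, and the threshold \<open>\<tau>\<close> is halfway between them.\<close>
  define \<delta> where "\<delta> = 1 / (8 * K)"
  define a where "a = real k * \<delta> / 4"
  define B where "B u = (if 0 < u then 1 else 0 :: real)" for u :: nat
  define q where "q w = (\<Sum>u\<le>M. w u * B u)" for w
  define \<tau> where "\<tau> = real k * q P + 2 * a"
  define \<phi> where "\<phi> ys = (if real_of_int (est ys) \<le> \<tau> then 1 else 0 :: real)" for ys
  define F where "F l = (if sum_list l \<le> k then sample_mean S \<phi> (urn k l) else 0)" for l
  \<comment> \<open>Chosen so that \<open>\<kappa>\<close> times the product of \<open>b\<close> is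
    at least 1 once the other slots hold more than \<open>k - M\<close> balls.\<close>
  define \<kappa> where "\<kappa> = exp (1 - real k / real M)"
  define \<epsilon> where "\<epsilon> = (2 * real n / real k) ^ L * G"
  have finS: "finite S" using ex by (simp add: exchangeable_def)
  have K0: "0 < K" using K by simp
  have pw: "prob_weights M P" "prob_weights M Q"
    unfolding P_def Q_def by (intro prob_weights_half_weights deg norm K0; simp)+
  have \<rho>: "1 \<le> \<rho>" "(\<Sum>u\<le>M. P u * b u) \<le> \<rho>" "(\<Sum>u\<le>M. Q u * b u) \<le> \<rho>"
    unfolding \<rho>_def P_def Q_def b_def
    using sum_half_weights_exp_le[OF deg(1) norm K0, of 1, OF _ M]
      sum_half_weights_exp_le[OF deg(1) norm K0, of "-1", OF _ M] by auto
  have f1: "poly f 1 = 0" using f L by (cases L) auto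
  have PQ: "P u - Q u = coeff f u * \<delta>" if "u \<le> M" for u
    using half_weights_diff[OF deg(1) f1 that, of "8 * K"] by (simp add: P_def Q_def \<delta>_def)
  have \<phi>01: "0 \<le> \<phi> ys" "\<phi> ys \<le> 1" for ys by (auto simp: \<phi>_def)
  have F01: "0 \<le> F l" "F l \<le> 1" for l
    using sample_mean_bounds[of \<phi>, OF \<phi>01] by (auto simp: F_def)
  have qw: "q w = 1 - w 0" if "prob_weights M w" for w
    using that unfolding q_def prob_weights_def atMost_insert_0 by (simp add: B_def)
  have qPQ: "q Q = q P + \<delta>" using qw[OF pw(1)] qw[OF pw(2)] PQ[of 0] f0 by simp
  \<comment> \<open>As \<open>1 \<le> \<Delta>\<close>, the margin \<open>2 * \<Delta>\<close>
    covers both the error of the estimator and the filling colour.\<close>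
  have a\<Delta>: "2 * \<Delta> \<le> a"
    using \<Delta> K0 by (simp add: a_def \<delta>_def pos_le_divide_eq mult_ac)
  have Y: "(\<Sum>x\<leftarrow>l. B x) = real (length (filter (\<lambda>u. 0 < u) l))" for l
    by (induction l) (auto simp: B_def)
  have bl: "(\<Prod>x\<leftarrow>l. b x) = exp (real (sum_list l) / real M)" for l
    unfolding b_def by (rule prod_list_exp)
  have \<delta>1: "0 < \<delta>" "\<delta> / 8 \<le> 1" using K by (auto simp: \<delta>_def divide_simps)
  have G0: "0 \<le> G" using gnorm pnorm_nonneg[of "\<lambda>_. 1" g] by simp
  have \<epsilon>0: "0 \<le> \<epsilon>" using G0 by (simp add: \<epsilon>_def)

  \<comment> \<open>If there is room for \<open>M\<close> more balls, the finite difference bound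
    gives the error \<open>\<epsilon>\<close>; otherwise the trivial bound 1 is paid for by
    \<open>\<kappa>\<close> and the exponential weight.\<close>
  have close: "\<bar>iid_mean M P k F - iid_mean M Q k F\<bar> \<le> real k * (\<epsilon> + \<kappa> * \<rho> ^ k)"
  proof (rule iid_mean_exchange[OF pw, of b])
    fix l1 l2 :: "nat list"
    have sl: "sum_list (l1 @ l2) = sum_list l1 + sum_list l2" by simp
    show "\<bar>\<Sum>u\<le>M. (P u - Q u) * F (l1 @ u # l2)\<bar> \<le> \<epsilon> + \<kappa> * (\<Prod>x\<leftarrow>l1 @ l2. b x)"
    proof (cases "sum_list l1 + sum_list l2 + M \<le> k")
      case True
      have "(\<Sum>u\<le>M. (P u - Q u) * F (l1 @ u # l2))
          = (\<Sum>u\<le>M. \<delta> * (coeff f u * sample_mean S \<phi> (urn k (l1 @ u # l2))))"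
        using True by (intro sum.cong refl) (auto simp: PQ F_def)
      also have "\<dots> = \<delta> * (\<Sum>u\<le>M. coeff f u * sample_mean S \<phi> (urn k (l1 @ u # l2)))"
        by (simp add: sum_distrib_left)
      finally have "\<bar>\<Sum>u\<le>M. (P u - Q u) * F (l1 @ u # l2)\<bar>
          = \<delta> * \<bar>\<Sum>u\<le>M. coeff f u * sample_mean S \<phi> (urn k (l1 @ u # l2))\<bar>"
        using \<delta>1 by (simp add: abs_mult)
      also have "\<dots> \<le> 1 * ((2 * real n / real k) ^ L * pnorm (\<lambda>_. 1) g)"
        using K \<phi>01 True by (intro mult_mono exchange_one_slot[OF ex nk _ f deg(2)])
          (auto simp: \<delta>_def divide_simps)
      also have "\<dots> \<le> \<epsilon>"
        unfolding \<epsilon>_def mult_1 by (intro mult_left_mono gnorm) auto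
      finally show ?thesis unfolding bl \<kappa>_def by (simp add: add_increasing2)
    next
      case False
      have mean01: "0 \<le> (\<Sum>u\<le>M. w u * F (l1 @ u # l2)) \<and> (\<Sum>u\<le>M. w u * F (l1 @ u # l2)) \<le> 1"
        if "prob_weights M w" for w
      proof -
        have w: "0 \<le> w u" "(\<Sum>u\<le>M. w u) = 1" for u using that by (auto simp: prob_weights_def)
        have "(\<Sum>u\<le>M. w u * F (l1 @ u # l2)) \<le> (\<Sum>u\<le>M. w u * 1)"
          by (intro sum_mono mult_left_mono w F01)
        then show ?thesis using w F01 by (auto intro!: sum_nonneg mult_nonneg_nonneg)
      qed
      have "\<bar>\<Sum>u\<le>M. (P u - Q u) * F (l1 @ u # l2)\<bar> \<le> 1"
        using mean01[OF pw(1)] mean01[OF pw(2)]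
        by (auto simp: left_diff_distrib sum_subtractf abs_le_iff)
      also have "1 \<le> exp (1 - real k / real M + real (sum_list l1 + sum_list l2) / real M)"
      proof -
        have "real k \<le> real M + real (sum_list l1 + sum_list l2)" using False by simp
        then have "real k / real M \<le> (real M + real (sum_list l1 + sum_list l2)) / real M"
          by (intro divide_right_mono) auto
        then show ?thesis using M by (simp add: add_divide_distrib)
      qed
      also have "\<dots> = \<kappa> * (\<Prod>x\<leftarrow>l1 @ l2. b x)"
        unfolding bl \<kappa>_def sl by (simp only: exp_add)
      finally show ?thesis using \<epsilon>0 by simp
    qed
  qed (use \<rho> \<epsilon>0 in \<open>auto simp: b_def \<kappa>_def\<close>)
  have \<rho>k: "\<rho> ^ k \<le> exp (real k / (4 * real M))"
  proof -
    have "\<rho> ^ k \<le> exp (1 / (4 * real M)) ^ k"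
      unfolding \<rho>_def by (intro power_mono exp_ge_add_one_self) auto
    then show ?thesis by (simp add: exp_of_nat_mult[symmetric])
  qed
  have exM: "- (real k / real M) + real k / (4 * real M) = - (3 * real k / (4 * real M))"
    using M by (simp add: field_simps)
  have "\<kappa> * \<rho> ^ k \<le> exp (1 - real k / real M) * exp (real k / (4 * real M))"
    unfolding \<kappa>_def by (intro mult_left_mono \<rho>k) auto
  also have "\<dots> = exp (1 - 3 * real k / (4 * real M))"
    unfolding exp_add[symmetric] using exM by simp
  finally have "real k * (\<epsilon> + \<kappa> * \<rho> ^ k) \<le> 1 / 10"
    using small mult_left_mono[of "\<epsilon> + \<kappa> * \<rho> ^ k" "\<epsilon> + exp (1 - 3 * real k / (4 * real M))" "real k"]
    unfolding \<epsilon>_def by linarith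
  then have close': "iid_mean M P k F \<le> iid_mean M Q k F + 1 / 10" using close by linarith

  \<comment> \<open>This \<open>s\<close> minimises the exponent \<open>k s^2 - s a\<close>.\<close>
  define s where "s = \<delta> / 8"
  have sk: "real k * s\<^sup>2 - s * a = - (real k / (4096 * K\<^sup>2))"
    using K0 by (simp add: s_def a_def \<delta>_def power2_eq_square field_simps)
  have tail: "iid_mean M w k (\<lambda>l. exp (s' * ((\<Sum>x\<leftarrow>l. B x) - real k * q w) - s * a)) \<le> 1 / 20"
    if w: "prob_weights M w" and s': "s' = s \<or> s' = - s" for w s'
  proof -
    have "exp (s' * ((\<Sum>x\<leftarrow>l. B x) - real k * q w) - s * a)
        = exp (- s * a) * exp (s' * ((\<Sum>x\<leftarrow>l. B x) - real k * q w))" for l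
      by (simp add: exp_add[symmetric])
    then have "iid_mean M w k (\<lambda>l. exp (s' * ((\<Sum>x\<leftarrow>l. B x) - real k * q w) - s * a))
        = exp (- s * a) * iid_mean M w k (\<lambda>l. exp (s' * ((\<Sum>x\<leftarrow>l. B x) - real k * q w)))"
      by (simp only: iid_mean_cmult)
    also have "\<dots> \<le> exp (- s * a) * exp (real k * s'\<^sup>2)"
      using s' \<delta>1 by (intro mult_left_mono iid_mean_exp_centered_le[OF w])
        (auto simp: B_def q_def s_def)
    also have "\<dots> = exp (- (real k / (4096 * K\<^sup>2)))"
      using s' sk by (auto simp: exp_add[symmetric])
    finally show ?thesis using tailY by linarith
  qed

  \<comment> \<open>Markov's inequality in exponential form: the integrand is at least 1 whenever
    the slots ask for more than \<open>k\<close> balls.\<close>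
  have "iid_mean M P k (\<lambda>l. exp (- (real k / real M)) * (\<Prod>x\<leftarrow>l. b x)) \<le> 1 / 20"
  proof -
    have "(\<Sum>u\<le>M. P u * b u) ^ k \<le> \<rho> ^ k"
      using \<rho> pw(1) by (intro power_mono sum_nonneg) (auto simp: prob_weights_def b_def)
    then have "exp (- (real k / real M)) * (\<Sum>u\<le>M. P u * b u) ^ k
        \<le> exp (- (real k / real M)) * exp (real k / (4 * real M))"
      using \<rho>k by (intro mult_left_mono) auto
    also have "\<dots> = exp (- (3 * real k / (4 * real M)))"
      unfolding exp_add[symmetric] exM ..
    finally show ?thesis using tailT by (simp add: iid_mean_cmult iid_mean_prod)
  qed
  \<comment> \<open>A pointwise union bound: either \<open>F\<close> is at least 9/10, or one of the
    two exponentials, for too many balls or too many nonempty slots, is at least 1.\<close>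
  moreover have "9 / 10 \<le> iid_mean M P k (\<lambda>l. F l + (exp (- (real k / real M)) * (\<Prod>x\<leftarrow>l. b x)
      + exp (s * ((\<Sum>x\<leftarrow>l. B x) - real k * q P) - s * a)))"
    (is "_ \<le> iid_mean M P k ?H")
  proof -
    have "9 / 10 \<le> ?H l" if "length l = k" for l
    proof -
      consider "k < sum_list l" | "a < (\<Sum>x\<leftarrow>l. B x) - real k * q P"
        | "sum_list l \<le> k" "(\<Sum>x\<leftarrow>l. B x) - real k * q P \<le> a"
        by linarith
      then show ?thesis
      proof cases
        case 1
        have "real k / real M \<le> real (sum_list l) / real M" using 1 by (intro divide_right_mono) auto
        then have "1 \<le> exp (- (real k / real M)) * (\<Prod>x\<leftarrow>l. b x)"
          unfolding bl exp_add[symmetric] by simp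
        then show ?thesis using F01[of l] by (smt (verit) exp_ge_zero divide_le_eq_1)
      next
        case 2
        have "s * a \<le> s * ((\<Sum>x\<leftarrow>l. B x) - real k * q P)"
          using 2 \<delta>1 by (intro mult_left_mono) (auto simp: s_def)
        then have "1 \<le> exp (s * ((\<Sum>x\<leftarrow>l. B x) - real k * q P) - s * a)" by simp
        moreover have "0 \<le> exp (- (real k / real M)) * (\<Prod>x\<leftarrow>l. b x)" by (simp add: bl)
        ultimately show ?thesis using F01[of l] by linarith
      next
        case 3
        have "1 - fail_prob S k ((!) (urn k l)) est \<Delta> \<le> sample_mean S \<phi> (urn k l)"
        proof (rule sample_mean_ge_1_minus_fail_prob[OF finS S \<phi>01(1)])
          fix ys
          assume "\<bar>real_of_int (est ys) - real (num_colors k ((!) (urn k l)))\<bar> < \<Delta>"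
          then have "real_of_int (est ys) \<le> \<tau>"
            using num_colors_urn(2)[OF 3(1)] 3(2) a\<Delta> \<Delta>(1) unfolding Y \<tau>_def by linarith
          then show "1 \<le> \<phi> ys" by (simp add: \<phi>_def)
        qed
        then have "9 / 10 \<le> F l" using good[of "(!) (urn k l)"] 3 by (simp add: F_def)
        moreover have "0 \<le> exp (- (real k / real M)) * (\<Prod>x\<leftarrow>l. b x)" by (simp add: bl)
        ultimately show ?thesis by (smt (verit) exp_ge_zero)
      qed
    qed
    then have "iid_mean M P k (\<lambda>_. 9 / 10) \<le> iid_mean M P k ?H"
      by (intro iid_mean_mono[OF pw(1)])
    then show ?thesis by (simp only: iid_mean_const[OF pw(1)])
  qed
  ultimately have lower: "8 / 10 \<le> iid_mean M P k F"
    using tail[OF pw(1), of s] by (simp only: iid_mean_add) linarith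

  \<comment> \<open>No term for too many balls is needed on this side, since \<open>F\<close> is 0
    there.\<close>
  have "iid_mean M Q k F \<le> iid_mean M Q k (\<lambda>l. 1 / 10 + exp (- s * ((\<Sum>x\<leftarrow>l. B x) - real k * q Q) - s * a))"
  proof (rule iid_mean_mono[OF pw(2)])
    fix l :: "nat list" assume "length l = k"
    consider "k < sum_list l" | "(\<Sum>x\<leftarrow>l. B x) - real k * q Q < - a"
      | "sum_list l \<le> k" "- a \<le> (\<Sum>x\<leftarrow>l. B x) - real k * q Q"
      by linarith
    then show "F l \<le> 1 / 10 + exp (- s * ((\<Sum>x\<leftarrow>l. B x) - real k * q Q) - s * a)"
    proof cases
      case 1
      then show ?thesis by (simp add: F_def add_nonneg_nonneg)
    next
      case 2
      have "s * ((\<Sum>x\<leftarrow>l. B x) - real k * q Q) \<le> s * (- a)"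
        using 2 \<delta>1 by (intro mult_left_mono) (auto simp: s_def)
      then have "1 \<le> exp (- s * ((\<Sum>x\<leftarrow>l. B x) - real k * q Q) - s * a)" by simp
      then show ?thesis using F01[of l] by linarith
    next
      case 3
      have kq: "real k * q Q = real k * q P + 4 * a" unfolding qPQ a_def by (simp add: distrib_left)
      have "sample_mean S \<phi> (urn k l) \<le> fail_prob S k ((!) (urn k l)) est \<Delta>"
      proof (rule sample_mean_le_fail_prob[OF finS \<phi>01(2)])
        fix ys
        assume "\<bar>real_of_int (est ys) - real (num_colors k ((!) (urn k l)))\<bar> < \<Delta>"
        then have "\<not> real_of_int (est ys) \<le> \<tau>"
          using num_colors_urn(1)[OF 3(1)] 3(2) a\<Delta> \<Delta>(1) unfolding Y kq \<tau>_def by linarith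
        then show "\<phi> ys \<le> 0" by (simp add: \<phi>_def)
      qed
      then have "F l \<le> 1 / 10" using good[of "(!) (urn k l)"] 3 by (simp add: F_def)
      then show ?thesis by (smt (verit) exp_ge_zero)
    qed
  qed
  also have "\<dots> \<le> 1 / 10 + 1 / 20"
    using tail[OF pw(2), of "- s"] by (simp add: iid_mean_add iid_mean_const[OF pw(2)])
  finally show False using lower close' by simp
qed

section \<open>Choice of the parameters\<close>

lemma power_base_poly:
  assumes m: "3 \<le> m"
  obtains g where "base_poly m ^ r = [:1, -1:] ^ (m * r) * g" "degree g + m * r \<le> m\<^sup>2 * r"
    "pnorm (\<lambda>_. 1) g \<le> (100 * real m) ^ (m * r)"
proof -
  obtain g where g: "base_poly m = [:1, -1:] ^ m * g" "degree g + m \<le> m\<^sup>2"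
    "pnorm (\<lambda>_. 1) g \<le> (100 * real m) ^ m"
    using base_poly_quotient[OF m] .
  show ?thesis
  proof (rule that[of "g ^ r"])
    show "base_poly m ^ r = [:1, -1:] ^ (m * r) * g ^ r"
      by (simp only: g(1) power_mult_distrib power_mult)
    have "degree (g ^ r) + m * r \<le> (degree g + m) * r"
      using degree_power_le[of g r] by (simp add: algebra_simps)
    also have "\<dots> \<le> m\<^sup>2 * r" using g(2) by (intro mult_right_mono) auto
    finally show "degree (g ^ r) + m * r \<le> m\<^sup>2 * r" .
    have "pnorm (\<lambda>_. 1) (g ^ r) \<le> pnorm (\<lambda>_. 1) g ^ r" by (rule pnorm_power_le) auto
    also have "\<dots> \<le> ((100 * real m) ^ m) ^ r" by (intro power_mono g(3) pnorm_nonneg) auto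
    finally show "pnorm (\<lambda>_. 1) (g ^ r) \<le> (100 * real m) ^ (m * r)" by (simp only: power_mult)
  qed
qed

text \<open>From \<open>exp y \<ge> (y / 6)^6\<close>. With \<open>y = ln k\<close> it shows that
  the largest slot size \<open>M\<close>, of order \<open>y^2\<close>, is small enough compared with
  \<open>k\<close>.\<close>

lemma cubic_le_exp:
  fixes y :: real
  assumes "100 \<le> y"
  shows "16 * y\<^sup>2 * (1 + 2 * y) \<le> 3 * exp y"
proof -
  have "y / 6 \<le> exp (y / 6)" using exp_ge_add_one_self[of "y / 6"] by linarith
  then have "(y / 6) ^ 6 \<le> exp (y / 6) ^ 6" using assms by (intro power_mono) auto
  also have "\<dots> = exp y" by (simp add: exp_of_nat_mult[symmetric])
  finally have e: "y ^ 3 * y ^ 3 / 46656 \<le> exp y" by (simp add: power_divide power_add[symmetric])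
  have "100 ^ 3 \<le> y ^ 3" using assms by (intro power_mono) auto
  then have "y ^ 3 * 100 ^ 3 \<le> y ^ 3 * y ^ 3" using assms by (intro mult_left_mono) auto
  then have "1000000 * y ^ 3 \<le> y ^ 3 * y ^ 3" by simp
  moreover have "0 \<le> y ^ 3" using assms by simp
  ultimately have "16 * y ^ 3 \<le> exp y" using e by linarith
  moreover have "16 * y\<^sup>2 * (1 + 2 * y) \<le> 48 * y ^ 3"
  proof -
    have "y\<^sup>2 * 1 \<le> y\<^sup>2 * y" using assms by (intro mult_left_mono) auto
    then show ?thesis by (simp add: power2_eq_square power3_eq_cube algebra_simps)
  qed
  ultimately show ?thesis by linarith
qed

lemma two_power_le_exp: "2 ^ n \<le> exp (real n)"
proof -
  have "(2::real) ^ n \<le> exp 1 ^ n" using exp_ge_add_one_self[of 1] by (intro power_mono) auto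
  then show ?thesis by (simp add: exp_of_nat_mult[symmetric])
qed

text \<open>The polynomial is the \<open>r\<close>-th power of \<open>base_poly m\<close>. The bound
  on \<open>n\<close> implies \<open>n \<le> k\<close>, so the hypothesis on \<open>S\<close> may be
  restricted to that range; this matters without replacement, where larger samples do not
  exist.\<close>

lemma not_achievable_of_few_samples:
  fixes k n :: nat and \<Delta> :: real
  assumes \<Delta>: "1 \<le> \<Delta>" "\<Delta> \<le> exp (-100) * real k" and k: "2 \<le> k"
    and n: "real n < 1 / (28800 * ln 300) * (real k / ln (real k)) * ln (real k / \<Delta>)"
    and ex: "n \<le> k \<Longrightarrow> exchangeable k n S \<and> S \<noteq> {}"
  shows "\<exists>u. fail_prob S k u est \<Delta> > 1 / 10"
proof -
  define x y where "x = ln (real k / \<Delta>)" and "y = ln (real k)"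
  define b :: real where "b = ln 300"
  have k0: "0 < real k" using k by simp
  have ex_x: "exp x = real k / \<Delta>" and ex_y: "exp y = real k" using k0 \<Delta> by (simp_all add: x_def y_def)
  have "exp 100 \<le> exp x"
    using \<Delta> unfolding ex_x by (simp add: exp_minus pos_le_divide_eq field_simps)
  then have x: "100 \<le> x" by simp
  have "exp x \<le> exp y" unfolding ex_x ex_y using \<Delta> k0 by (simp add: divide_le_eq)
  then have xy: "x \<le> y" by simp
  then have y: "100 \<le> y" using x by simp
  have eb: "exp b = 300" by (simp add: b_def)
  have b1: "1 \<le> b"
  proof -
    have "exp (1::real) \<le> exp b" unfolding eb using exp_le by linarith
    then show ?thesis by simp
  qed
  have b25: "b \<le> 25"
  proof -
    have "exp b \<le> exp (25::real)" unfolding eb using two_power_le_exp[of 25] by simp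
    then show ?thesis by simp
  qed
  \<comment> \<open>The largest \<open>r\<close> for which \<open>300^r\<close>, the bound
    \<open>K\<close> on the weighted norm, is at most \<open>(k / \<Delta>)^(1/4)\<close>.\<close>
  define r where "r = nat \<lfloor>x / (4 * b)\<rfloor>"
  have xb: "1 \<le> x / (4 * b)" using x b1 b25 by (simp add: pos_le_divide_eq)
  have r_le: "real r \<le> x / (4 * b)" unfolding r_def using xb by (simp add: of_nat_nat)
  have r1: "1 \<le> r" unfolding r_def using xb by (simp add: le_nat_iff)
  have r_ge: "x / (8 * b) \<le> real r"
  proof -
    have "x / (4 * b) < real r + 1" unfolding r_def using xb by (simp add: of_nat_nat)
    then have "x / (4 * b) < 2 * real r" using r1 by simp
    then show ?thesis using b1 by (simp add: field_simps)
  qed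
  have r0: "0 < real r" using r1 by simp
  \<comment> \<open>This puts \<open>L = m * r\<close> between \<open>y\<close> and
    \<open>2 * y\<close>.\<close>
  define m where "m = nat \<lceil>y / real r\<rceil>"
  have rb: "4 * b * real r \<le> y" using r_le xy b1 by (simp add: pos_le_divide_eq mult.commute)
  have yr: "4 \<le> y / real r"
  proof -
    have "4 * real r \<le> 4 * b * real r" using b1 r0 by simp
    then have "4 * real r \<le> y" using rb by linarith
    then show ?thesis using r0 by (simp add: pos_le_divide_eq)
  qed
  have m_ge: "y / real r \<le> real m" unfolding m_def by (rule real_nat_ceiling_ge)
  have m3: "3 \<le> m" using m_ge yr by linarith
  have m_le: "real m \<le> 2 * y / real r"
  proof -
    have "real m < y / real r + 1" unfolding m_def using yr by (simp add: of_nat_nat) linarith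
    then show ?thesis using yr by simp
  qed
  have mr_ge: "y \<le> real (m * r)" using m_ge r0 by (simp add: pos_divide_le_eq)
  have mr_le: "real m * real r \<le> 2 * y" using m_le r0 by (simp add: pos_le_divide_eq)
  define L M where "L = m * r" and "M = m\<^sup>2 * r"
  have M1: "1 \<le> M" using m3 r1 by (simp add: M_def)
  have M_le: "real M \<le> 4 * y\<^sup>2"
  proof -
    have "real M \<le> real M * real r" using r1 by (simp add: mult_le_cancel_left1)
    also have "\<dots> = (real m * real r)\<^sup>2" by (simp add: M_def power2_eq_square mult_ac)
    also have "\<dots> \<le> (2 * y)\<^sup>2" using mr_le by (intro power_mono) auto
    finally show ?thesis by (simp add: power_mult_distrib)
  qed
  define K :: real where "K = 300 ^ r"
  have K1: "1 \<le> K" by (simp add: K_def)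
  have K_le: "K \<le> exp (x / 4)"
  proof -
    have "K = exp (real r * b)" by (simp add: K_def exp_of_nat_mult eb)
    also have "\<dots> \<le> exp (x / 4)" using r_le b1 by (simp add: field_simps)
    finally show ?thesis .
  qed
  \<comment> \<open>Here 28800 is split as 3600 * 8: the 8 belongs to the lower bound of
    \<open>r\<close>, and 3600 gives \<open>n m \<le> k / 1800\<close> by
    \<open>m \<le> 2 y / r\<close>.\<close>
  have nm: "200 * real n * real m \<le> real k / 9"
  proof -
    have y0: "0 < y" using y by simp
    have "real n < (real k / (3600 * y)) * (x / (8 * b))"
      using n by (simp add: x_def y_def b_def mult_ac)
    also have "\<dots> \<le> (real k / (3600 * y)) * real r"
      using r_ge y0 by (intro mult_left_mono) auto
    finally have n': "real n \<le> (real k / (3600 * y)) * real r" by simp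
    have "real n * real m \<le> ((real k / (3600 * y)) * real r) * (2 * y / real r)"
      using n' m_le by (intro mult_mono) auto
    also have "\<dots> = real k / 1800" using y0 r0 by (simp add: field_simps)
    finally show ?thesis by simp
  qed
  have nk: "n \<le> k"
  proof -
    have "real n * 1 \<le> real n * real m" using m3 by (intro mult_left_mono) auto
    then have "real n \<le> real k" using nm by linarith
    then show ?thesis by simp
  qed
  obtain g where g: "base_poly m ^ r = [:1, -1:] ^ L * g" "degree g + L \<le> M"
    "pnorm (\<lambda>_. 1) g \<le> (100 * real m) ^ L"
    unfolding L_def M_def using power_base_poly[OF m3] .
  \<comment> \<open>This makes the error term for overfull urns at most
    \<open>1 / k^2\<close>.\<close>
  have kbig: "1 + 2 * y \<le> 3 * real k / (4 * real M)"
  proof -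
    have "(1 + 2 * y) * (4 * real M) \<le> (1 + 2 * y) * (16 * y\<^sup>2)"
      using M_le y by (intro mult_left_mono) auto
    also have "\<dots> \<le> 3 * real k" using cubic_le_exp[OF y] by (simp add: ex_y mult_ac)
    finally show ?thesis using M1 by (simp add: pos_le_divide_eq)
  qed
  have k_ge: "40 \<le> real k"
  proof -
    have "(2::real) ^ 6 \<le> exp (real 6)" by (rule two_power_le_exp)
    also have "\<dots> \<le> exp y" using y by simp
    finally show ?thesis by (simp add: ex_y)
  qed
  have inv: "exp (- (2 * y)) = 1 / (real k * real k)"
    by (simp add: exp_minus ex_y[symmetric] exp_add[symmetric] divide_inverse)
  \<comment> \<open>The base is at most 1/9 and hence at most \<open>exp (-2)\<close>, and the
    exponent \<open>L\<close> is at least \<open>ln k\<close>.\<close>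
  have eps: "(2 * real n / real k) ^ L * (100 * real m) ^ L \<le> 1 / (real k * real k)"
  proof -
    have "(2 * real n / real k) ^ L * (100 * real m) ^ L = (200 * real n * real m / real k) ^ L"
      by (simp only: power_mult_distrib[symmetric]) (simp add: mult_ac)
    also have "\<dots> \<le> exp (-2) ^ L"
    proof (rule power_mono)
      have "exp 2 \<le> (9::real)"
        using power_mono[OF exp_le, of 2] by (simp add: exp_of_nat_mult[symmetric])
      then have "1 / 9 \<le> (exp (-2) :: real)" by (simp add: exp_minus field_simps)
      moreover have "200 * real n * real m / real k \<le> 1 / 9"
        using nm k0 by (simp add: pos_divide_le_eq)
      ultimately show "200 * real n * real m / real k \<le> exp (-2)" by linarith
    qed auto
    also have "\<dots> = exp (- (2 * real L))" by (simp add: exp_of_nat_mult[symmetric] mult.commute)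
    also have "\<dots> \<le> exp (- (2 * y))" using mr_ge by (simp add: L_def)
    finally show ?thesis by (simp only: inv)
  qed
  show ?thesis
  proof (rule exists_urn_with_large_fail_prob[OF _ _ nk g(1) _ g(2) _ M1 _ _ K1 g(3)])
    show "exchangeable k n S" "S \<noteq> {}" using ex[OF nk] by auto
    have "degree (base_poly m ^ r) \<le> degree (base_poly m) * r" by (rule degree_power_le)
    also have "\<dots> \<le> M" unfolding M_def using degree_base_poly[of m] m3 by (intro mult_right_mono) auto
    finally show "degree (base_poly m ^ r) \<le> M" .
    show "1 \<le> L" using m3 r1 by (simp add: L_def)
    show "coeff (base_poly m ^ r) 0 = 1"
      using coeff_base_poly_0[of m] by (simp add: poly_0_coeff_0[symmetric])
    have "pnorm (\<lambda>i. 1 + real i) (base_poly m ^ r) \<le> pnorm (\<lambda>i. 1 + real i) (base_poly m) ^ r"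
      by (rule pnorm_power_le) (auto simp: algebra_simps)
    also have "\<dots> \<le> K" unfolding K_def
      using m3 by (intro power_mono pnorm_base_poly_le pnorm_nonneg) auto
    finally show "pnorm (\<lambda>i. 1 + real i) (base_poly m ^ r) \<le> K" .
    have "exp (1 - 3 * real k / (4 * real M)) \<le> exp (- (2 * y))" using kbig by simp
    then have "(2 * real n / real k) ^ L * (100 * real m) ^ L + exp (1 - 3 * real k / (4 * real M))
        \<le> 2 / (real k * real k)"
      using eps unfolding inv by simp
    then have "real k * ((2 * real n / real k) ^ L * (100 * real m) ^ L + exp (1 - 3 * real k / (4 * real M)))
        \<le> real k * (2 / (real k * real k))"
      by (intro mult_left_mono) auto
    also have "\<dots> = 2 / real k" using k0 by simp
    also have "\<dots> \<le> 1 / 10" using k_ge by (simp add: divide_simps)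
    finally show "real k * ((2 * real n / real k) ^ L * (100 * real m) ^ L
        + exp (1 - 3 * real k / (4 * real M))) \<le> 1 / 10" .
    have e5: "exp (-5) \<le> (1 / 20 :: real)"
      using two_power_le_exp[of 5] by (simp add: exp_minus field_simps)
    have "exp (- (3 * real k / (4 * real M))) \<le> exp (-5)" using kbig y by simp
    then show "exp (- (3 * real k / (4 * real M))) \<le> 1 / 20" using e5 by linarith
    show "1 \<le> \<Delta>" by (rule \<Delta>)
    \<comment> \<open>Of \<open>k / \<Delta> = exp x\<close>, a quarter of the exponent pays for
      \<open>K\<close> and the rest for 64.\<close>
    have x3: "64 \<le> exp (3 * x / 4)"
    proof -
      have "(2::real) ^ 6 \<le> exp (real 6)" by (rule two_power_le_exp)
      also have "\<dots> \<le> exp (3 * x / 4)" using x by simp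
      finally show ?thesis by simp
    qed
    have "64 * K \<le> exp (3 * x / 4) * exp (x / 4)"
      using x3 K_le K1 by (intro mult_mono) auto
    also have "\<dots> = real k / \<Delta>" by (simp add: exp_add[symmetric] ex_x[symmetric])
    finally show "64 * K * \<Delta> \<le> real k" using \<Delta> by (simp add: pos_le_divide_eq)
    \<comment> \<open>\<open>K^2\<close> is at most the square root of \<open>k\<close>; the factor
      5 is there because \<open>exp (-5) \<le> 1 / 20\<close>.\<close>
    have "5 * 4096 * K\<^sup>2 \<le> real k"
    proof -
      have "K\<^sup>2 \<le> (exp (x / 4))\<^sup>2" using K_le K1 by (intro power_mono) auto
      also have "\<dots> = exp (x / 2)" by (simp add: exp_of_nat_mult[symmetric])
      also have "\<dots> \<le> exp (y / 2)" using xy by simp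
      finally have K2: "K\<^sup>2 \<le> exp (y / 2)" .
      have "(2::real) ^ 15 \<le> exp (real 15)" by (rule two_power_le_exp)
      also have "\<dots> \<le> exp (y / 2)" using y by simp
      finally have "5 * 4096 \<le> exp (y / 2)" by simp
      then have "5 * 4096 * K\<^sup>2 \<le> exp (y / 2) * exp (y / 2)"
        using K2 by (intro mult_mono) auto
      then show ?thesis by (simp add: exp_add[symmetric] ex_y)
    qed
    then have "5 \<le> real k / (4096 * K\<^sup>2)" using K1 by (simp add: pos_le_divide_eq)
    then have "exp (- (real k / (4096 * K\<^sup>2))) \<le> exp (-5)" by simp
    then show "exp (- (real k / (4096 * K\<^sup>2))) \<le> 1 / 20" using e5 by linarith
  qed
qed

section \<open>Existence of achievable sample sizes\<close>

text \<open>More than \<open>k\<close> balls cannot be drawn without replacement, so the sample set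
  is empty and the division by 0 makes the failure probability 0. This settles that
  \<open>LEAST\<close> ranges over a nonempty set.\<close>

lemma achievable_wor: "\<exists>n. achievable samples_wor k \<Delta> n"
proof
  have "samples_wor k (Suc k) = {}"
  proof -
    have False if "xs \<in> samples_wor k (Suc k)" for xs
      using that card_mono[of "{..<k}" "set xs"] by (auto simp: samples_wor_def distinct_card)
    then show ?thesis by auto
  qed
  then show "achievable samples_wor k \<Delta> (Suc k)" by (simp add: achievable_def fail_prob_def)
qed

lemma card_samples_wr: "card (samples_wr k n) = k ^ n"
  unfolding samples_wr_def using card_lists_length_eq[of "{..<k}" n] by (simp add: conj_commute)

text \<open>Counting the colours seen fails only if some ball is missed, and by the union bound this
  has probability at most \<open>k (1 - 1/k)^n\<close>, which tends to 0.\<close>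

lemma achievable_wr:
  assumes k: "2 \<le> k" and \<Delta>: "0 < \<Delta>"
  shows "\<exists>n. achievable samples_wr k \<Delta> n"
proof -
  have "(\<lambda>n. real k * (1 - 1 / real k) ^ n) \<longlonglongrightarrow> real k * 0"
    using k by (intro tendsto_mult tendsto_const LIMSEQ_realpow_zero) auto
  then have "\<forall>\<^sub>F n in sequentially. real k * (1 - 1 / real k) ^ n < 1 / 10"
    by (rule order_tendstoD(2)) simp
  then have "\<exists>n. real k * (1 - 1 / real k) ^ n < 1 / 10"
    by (rule eventually_happens'[OF sequentially_bot])
  then obtain n where n: "real k * (1 - 1 / real k) ^ n < 1 / 10" ..
  have "fail_prob (samples_wr k n) k u (\<lambda>ys. int (card (set ys))) \<Delta> \<le> 0.1" for u
  proof -
    let ?bad = "{xs \<in> samples_wr k n.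
      \<Delta> \<le> \<bar>real_of_int (int (card (set (map u xs)))) - real (num_colors k u)\<bar>}"
    let ?miss = "\<lambda>b. {xs. set xs \<subseteq> {..<k} - {b} \<and> length xs = n}"
    have sub: "?bad \<subseteq> (\<Union>b<k. ?miss b)"
    proof
      fix xs assume xs: "xs \<in> ?bad"
      have "set xs \<noteq> {..<k}"
      proof
        assume "set xs = {..<k}"
        then have "card (set (map u xs)) = num_colors k u" by (simp add: num_colors_def)
        then show False using xs \<Delta> by simp
      qed
      moreover have "set xs \<subseteq> {..<k}" "length xs = n" using xs by (simp_all add: samples_wr_def)
      ultimately obtain b where "b < k" "b \<notin> set xs" by blast
      then show "xs \<in> (\<Union>b<k. ?miss b)"
        using \<open>set xs \<subseteq> {..<k}\<close> \<open>length xs = n\<close> by blast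
    qed
    have fin: "finite (?miss b)" for b by (rule finite_lists_length_eq) simp
    have "card ?bad \<le> card (\<Union>b<k. ?miss b)" by (rule card_mono[OF _ sub]) (use fin in auto)
    also have "\<dots> \<le> (\<Sum>b<k. card (?miss b))" by (rule card_UN_le) simp
    also have "\<dots> = (\<Sum>b<k. (k - 1) ^ n)"
      by (intro sum.cong refl) (subst card_lists_length_eq, auto simp: card_Diff_singleton_if)
    finally have "card ?bad \<le> k * (k - 1) ^ n" by simp
    then have "real (card ?bad) \<le> real (k * (k - 1) ^ n)" by (simp only: of_nat_le_iff)
    then have "real (card ?bad) / real (k ^ n) \<le> real k * (real k - 1) ^ n / real k ^ n"
      using k by (simp add: divide_right_mono of_nat_diff)
    also have "\<dots> = real k * ((real k - 1) / real k) ^ n" by (simp add: power_divide)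
    also have "(real k - 1) / real k = 1 - 1 / real k" using k by (simp add: diff_divide_distrib)
    finally have "real (card ?bad) / real (k ^ n) \<le> 1 / 10" using n by linarith
    then show ?thesis unfolding fail_prob_def card_samples_wr by simp
  qed
  then show ?thesis unfolding achievable_def by blast
qed

lemma samples_wr_nonempty: "2 \<le> k \<Longrightarrow> samples_wr k n \<noteq> {}"
  using card_samples_wr[of k n] by auto

lemma samples_wor_nonempty:
  assumes "n \<le> k"
  shows "samples_wor k n \<noteq> {}"
proof -
  have "[0..<n] \<in> samples_wor k n" using assms by (auto simp: samples_wor_def)
  then show ?thesis by auto
qed

text \<open>The least achievable \<open>n\<close> is itself achievable, given that one exists, and
  so cannot lie below the bound.\<close>

lemma sample_complexity_lower_bound:
  assumes "\<exists>n. achievable samp k \<Delta> n"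
    and "\<And>n. n \<le> k \<Longrightarrow> exchangeable k n (samp k n) \<and> samp k n \<noteq> {}"
    and "1 \<le> \<Delta>" "\<Delta> \<le> exp (-100) * real k" "2 \<le> k"
  shows "1 / (28800 * ln 300) * (real k / ln (real k)) * ln (real k / \<Delta>)
    \<le> real (LEAST n. achievable samp k \<Delta> n)"
proof (rule ccontr)
  define n where "n = (LEAST n. achievable samp k \<Delta> n)"
  assume "\<not> ?thesis"
  then have "real n < 1 / (28800 * ln 300) * (real k / ln (real k)) * ln (real k / \<Delta>)"
    by (simp add: n_def)
  then have "\<exists>u. fail_prob (samp k n) k u est \<Delta> > 1 / 10" for est
    using assms by (intro not_achievable_of_few_samples) auto
  moreover have "achievable samp k \<Delta> n" unfolding n_def by (rule LeastI_ex[OF assms(1)])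
  ultimately show False unfolding achievable_def by (metis divide_numeral_1 not_less)
qed

theorem theorem4:
  shows "\<exists>c c' :: real. c > 0 \<and> c' > 0 \<and>
    (\<forall>(k::nat) (\<Delta>::real). k \<ge> 2 \<and> 1 \<le> \<Delta> \<and> \<Delta> \<le> c * real k \<longrightarrow>
       real (sample_complexity_wr k \<Delta>) \<ge> c' * (real k / ln (real k)) * ln (real k / \<Delta>) \<and>
       real (sample_complexity_wor k \<Delta>) \<ge> c' * (real k / ln (real k)) * ln (real k / \<Delta>))"
proof (intro exI conjI allI impI)
  fix k :: nat and \<Delta> :: real
  assume *: "k \<ge> 2 \<and> 1 \<le> \<Delta> \<and> \<Delta> \<le> exp (-100) * real k"
  show "1 / (28800 * ln 300) * (real k / ln (real k)) * ln (real k / \<Delta>) \<le> real (sample_complexity_wr k \<Delta>)"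
    unfolding sample_complexity_wr_def using *
    by (intro sample_complexity_lower_bound achievable_wr)
      (auto simp: exchangeable_samples_wr samples_wr_nonempty)
  show "1 / (28800 * ln 300) * (real k / ln (real k)) * ln (real k / \<Delta>) \<le> real (sample_complexity_wor k \<Delta>)"
    unfolding sample_complexity_wor_def using *
    by (intro sample_complexity_lower_bound achievable_wor)
      (auto simp: exchangeable_samples_wor samples_wor_nonempty)
qed auto

end
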